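(* Let $D\subset\mathbb{C}$ be a bounded domain of finite connectivity whose boundary consists of a finite number of smooth closed curves $C_1,\ldots,C_k$, none of which degenerates to a point. Let $f:\mathbb{D}\to D$ be a holomorphic universal covering map, invariant under the Fuchsian group $G$ acting on $\mathbb{D}$ with $D$ conformally equivalent to $\mathbb{D}/G$, and let $L\subset\partial\mathbb{D}$ be the limit set of $G$. Then, for every $\theta$, $$\mathcal{E}(r,\theta)=O\big(\ell(r)\big)\qquad\text{as } r\to1 .$$ Moreover: (i) if $e^{i\theta}\notin L$, then $\mathcal{E}(r,\theta)=O(1)$ as $r\to1$; and (ii) if $e^{i\theta}$ is fixed by some hyperbolic element of $G$ (and such points are dense in $L$), then there is some positive number $K$ (depending on $\theta$) such that $\mathcal{E}(r,\theta)\geqslant K\,\ell(r)$ for all $r\in[0,1)$.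
   Context: $\mathbb{D}=\{|z|<1\}$. $\mathcal{E}(r,\theta)=\int_0^r|f'(te^{i\theta})|\,dt$ is the Euclidean length (with multiplicity) of the image under $f$ of the segment $[0,re^{i\theta}]$, and $\ell(r)=\log\frac{1+r}{1-r}$ is the hyperbolic length of $[0,re^{i\theta}]$ for the metric $2|dz|/(1-|z|^2)$. $G$ is the group of deck (cover) transformations of $f$. The boundary curves are pairwise disjoint, regular, simple closed curves; smooth means $C^\infty$. *)

theory Defs
  imports
    "HOL-Complex_Analysis.Complex_Analysis"
    "HOL-Library.Landau_Symbols"
    "HOL-Library.FuncSet"
begin

abbreviation unit_disc :: "complex set"
  where "unit_disc \<equiv> ball 0 1"

definition smooth_curve :: "(real \<Rightarrow> complex) \<Rightarrow> bool"
  where "smooth_curve \<gamma> \<longleftrightarrow>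
    (\<forall>n t. ((\<lambda>g s. vector_derivative g (at s)) ^^ n) \<gamma> differentiable (at t))"

text \<open>
  Closed curves are parametrised by 1-periodic functions on the whole line, so that smoothness
  and regularity include the point at which the curve closes up.
\<close>

definition smooth_closed_curve :: "complex set \<Rightarrow> bool"
  where "smooth_closed_curve C \<longleftrightarrow>
    (\<exists>\<gamma> :: real \<Rightarrow> complex.
        smooth_curve \<gamma> \<and>
        (\<forall>t. \<gamma> (t + 1) = \<gamma> t) \<and>
        (\<forall>t. vector_derivative \<gamma> (at t) \<noteq> 0) \<and>
        inj_on \<gamma> {0..<1} \<and>
        C = range \<gamma>)"

text \<open>
  Deck transformations are self-homeomorphisms of the disc over \<open>f\<close>; when \<open>f\<close> is a holomorphic
  covering map they are automatically conformal automorphisms of the disc. Extensionality only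
  makes a deck transformation determined by its values on the disc.
\<close>

definition deck_group :: "(complex \<Rightarrow> complex) \<Rightarrow> (complex \<Rightarrow> complex) set"
  where "deck_group f =
    {g \<in> extensional unit_disc.
       (\<exists>h. homeomorphism unit_disc unit_disc g h) \<and> (\<forall>z \<in> unit_disc. f (g z) = f z)}"

definition limit_set :: "(complex \<Rightarrow> complex) set \<Rightarrow> complex set"
  where "limit_set G = {\<zeta>. \<exists>z \<in> unit_disc. \<zeta> islimpt {g z | g. g \<in> G}}"

text \<open>
  The action of a conformal automorphism of the disc on the unit circle is that of its continuous
  extension, hence the boundary values are taken as limits from inside the disc.
\<close>

definition boundary_fixed_points :: "(complex \<Rightarrow> complex) \<Rightarrow> complex set"
  where "boundary_fixed_points g = {\<zeta> \<in> sphere 0 1. (g \<longlongrightarrow> \<zeta>) (at \<zeta> within unit_disc)}"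

text \<open>
  A conformal automorphism of the disc is hyperbolic if it has exactly two fixed points in the
  closed disc, both on the unit circle.
\<close>

definition hyperbolic :: "(complex \<Rightarrow> complex) \<Rightarrow> bool"
  where "hyperbolic g \<longleftrightarrow>
    g holomorphic_on unit_disc \<and> bij_betw g unit_disc unit_disc \<and>
    (\<forall>z \<in> unit_disc. g z \<noteq> z) \<and> card (boundary_fixed_points g) = 2"

definition hyperbolic_fixed_points :: "(complex \<Rightarrow> complex) set \<Rightarrow> complex set"
  where "hyperbolic_fixed_points G = (\<Union>g \<in> {g \<in> G. hyperbolic g}. boundary_fixed_points g)"

definition euclidean_length :: "(complex \<Rightarrow> complex) \<Rightarrow> real \<Rightarrow> real \<Rightarrow> real"
  where "euclidean_length f r \<theta> = integral {0..r} (\<lambda>t. norm (deriv f (of_real t * cis \<theta>)))"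

text \<open>
  Length of the segment from \<open>0\<close> to \<open>r * cis \<theta>\<close> for the metric \<open>2|dz|/(1 - |z|^2)\<close>;
  it does not depend on \<open>\<theta>\<close>.
\<close>

definition hyperbolic_length :: "real \<Rightarrow> real"
  where "hyperbolic_length r = ln ((1 + r) / (1 - r))"

end

theory Submission
  imports Defs
begin

text \<open>
  Since \<open>D\<close> is bounded, the Schwarz lemma gives \<open>\<bar>f' z\<bar> (1 - \<bar>z\<bar>) = O(1)\<close>, hence the first claim.

  For a regular point \<open>\<omega>\<close> of the circle, the preimage of a compact subset of \<open>D\<close> stays away from \<open>\<omega>\<close>, so the
  Poisson kernel at \<open>\<omega>\<close> is bounded there. Smoothness makes the boundary locally a Lipschitz graph; walking
  away from it and lifting the walk, Harnack's inequality compares the kernel \<open>\<ge> 1 / (1 - r)\<close> at \<open>z = r\<omega>\<close>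
  with its bounded value at the end of the walk and yields \<open>\<bar>f z - q\<bar>\<^sup>4 = O(1 - r)\<close> for a boundary point \<open>q\<close>.
  The Schwarz lemma for a square root of \<open>f - q\<close> bounds \<open>\<bar>f' z\<bar> (1 - r)\<close> by a multiple of the square root of
  \<open>\<bar>f z - q\<bar>\<close>, so \<open>\<bar>f'\<bar> = O((1 - r) powr (-7/8))\<close> is integrable along the radius.

  In the half-plane coordinate at a boundary fixed point, a deck transformation is \<open>w \<mapsto> \<kappa> w + \<i> \<beta>\<close> with
  \<open>\<kappa> > 0\<close>. If \<open>\<kappa> \<noteq> 1\<close>, its iterates bring the radius at that point into a compact set, so \<open>f\<close> maps the radius
  into a compact subset of \<open>D\<close>, over which \<open>\<bar>f' z\<bar> (1 - \<bar>z\<bar>)\<close> is bounded below. The case \<open>\<kappa> = 1\<close> does not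
  occur: it would yield arbitrarily small loops in \<open>D\<close> that do not lift to loops. So all nontrivial deck
  transformations are hyperbolic; for the fixed point \<open>a\<close> with \<open>\<kappa> > 1\<close> the Poisson kernel at \<open>a\<close> grows under
  \<open>g\<close>, which forces \<open>a\<close> to be close to \<open>g z\<close> when \<open>g z\<close> is close to the circle.
\<close>

section \<open>Schwarz estimates for half-plane valued functions\<close>

text \<open>The squares of the two norms differ by \<open>4 * Re a * Re b\<close>.\<close>

lemma half_plane_quotient_lt_1:
  assumes "Re a > 0" "Re b > 0"
  shows "norm ((a - b) / (a + cnj b)) < 1"
proof -
  have "(norm (a - b))\<^sup>2 < (norm (a + cnj b))\<^sup>2"
    using mult_pos_pos[OF assms] unfolding cmod_power2
    by (simp add: power2_eq_square algebra_simps)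
  then have "norm (a - b) < norm (a + cnj b)"
    by (simp add: power_less_imp_less_base)
  then show ?thesis
    by (simp add: norm_divide divide_less_eq)
qed

text \<open>The map \<open>\<lambda>x. (x - h w) / (x + cnj (h w))\<close> carries the right
  half-plane into the disc and \<open>h w\<close> to 0, so the Schwarz lemma applies. Since
  \<open>norm (h z + cnj (h w))\<close> is at most \<open>norm (h z - h w) + 2 * Re (h w)\<close>,
  the difference can be absorbed on the left. This form of Harnack's inequality controls the
  imaginary part as well.\<close>

lemma half_plane_schwarz:
  assumes h: "h holomorphic_on ball w R" and "R > 0"
    and pos: "\<And>z. z \<in> ball w R \<Longrightarrow> Re (h z) > 0"
    and z: "z \<in> ball w R"
  shows "norm (h z - h w) * (R - dist w z) \<le> 2 * dist w z * Re (h w)"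
proof -
  define u where "u = (\<lambda>x. (h (w + of_real R * x) - h w) / (h (w + of_real R * x) + cnj (h w)))"
  have inb: "w + of_real R * x \<in> ball w R" if "norm x < 1" for x
    using that \<open>R > 0\<close> by (simp add: dist_norm norm_mult)
  have ww: "w \<in> ball w R" using \<open>R > 0\<close> by simp
  have nz: "h (w + of_real R * x) + cnj (h w) \<noteq> 0" if "norm x < 1" for x
  proof
    assume "h (w + of_real R * x) + cnj (h w) = 0"
    then have "Re (h (w + of_real R * x)) + Re (h w) = 0"
      by (metis cnj.simps(1) plus_complex.simps(1) zero_complex.simps(1))
    then show False using pos[OF inb[OF that]] pos[OF ww] by linarith
  qed
  have holc: "(\<lambda>x. h (w + of_real R * x)) holomorphic_on ball 0 1"
    using holomorphic_on_compose_gen[of "\<lambda>x. w + of_real R * x" "ball 0 1" h "ball w R"] h inb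
    by (force simp: o_def intro!: holomorphic_intros)
  have holu: "u holomorphic_on ball 0 1"
    unfolding u_def by (intro holomorphic_intros holc) (use nz in auto)
  have u1: "norm (u x) < 1" if "norm x < 1" for x
    unfolding u_def using half_plane_quotient_lt_1[of "h (w + of_real R * x)" "h w"]
      pos inb[OF that] ww by blast
  define x where "x = (z - w) / of_real R"
  have nx: "norm x = dist w z / R"
    using \<open>R > 0\<close> by (simp add: x_def norm_divide dist_norm norm_minus_commute)
  have x1: "norm x < 1" using z \<open>R > 0\<close> by (simp add: nx)
  have wx: "w + of_real R * x = z" using \<open>R > 0\<close> by (simp add: x_def)
  have "norm (u x) \<le> norm x"
    by (rule Schwarz_Lemma(1)[OF holu _ _ x1]) (use u1 in \<open>auto simp: u_def\<close>)
  then have "norm (h z - h w) \<le> norm x * norm (h z + cnj (h w))"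
    using nz[OF x1] by (simp add: u_def wx norm_divide divide_le_eq)
  also have "norm (h z + cnj (h w)) \<le> norm (h z - h w) + 2 * Re (h w)"
  proof -
    have eq: "h z + cnj (h w) = (h z - h w) + of_real (2 * Re (h w))"
      by (simp add: complex_eq_iff)
    show ?thesis
      unfolding eq by (rule order_trans[OF norm_triangle_ineq], use pos[OF ww] in \<open>simp del: of_real_mult\<close>)
  qed
  finally have "norm (h z - h w) \<le> norm x * (norm (h z - h w) + 2 * Re (h w))"
    by (simp add: mult_left_mono)
  then have "norm (h z - h w) * R \<le> dist w z * (norm (h z - h w) + 2 * Re (h w))"
    using \<open>R > 0\<close> by (simp add: nx field_simps)
  then show ?thesis by (simp add: algebra_simps)
qed

text \<open>Division of \<open>half_plane_schwarz\<close> by \<open>dist w z\<close>, followed by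
  the limit as \<open>z\<close> tends to \<open>w\<close>.\<close>

lemma half_plane_schwarz_deriv:
  assumes h: "h holomorphic_on ball w R" and "R > 0"
    and pos: "\<And>z. z \<in> ball w R \<Longrightarrow> Re (h z) > 0"
  shows "norm (deriv h w) * R \<le> 2 * Re (h w)"
proof -
  have "(h has_field_derivative deriv h w) (at w)"
    using h \<open>R > 0\<close> holomorphic_derivI[OF h open_ball] by simp
  then have "((\<lambda>z. (h z - h w) / (z - w)) \<longlongrightarrow> deriv h w) (at w)"
    by (simp add: has_field_derivative_iff)
  then have "((\<lambda>z. norm ((h z - h w) / (z - w)) * (R - dist w z)) \<longlongrightarrow> norm (deriv h w) * (R - dist w w)) (at w)"
    by (intro tendsto_intros)
  moreover have "\<forall>\<^sub>F z in at w. norm ((h z - h w) / (z - w)) * (R - dist w z) \<le> 2 * Re (h w)"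
    unfolding eventually_at
  proof (intro exI[of _ R] conjI ballI impI \<open>R > 0\<close>)
    fix z assume z: "z \<noteq> w \<and> dist z w < R"
    then have "norm (h z - h w) * (R - dist w z) \<le> 2 * dist w z * Re (h w)"
      by (intro half_plane_schwarz[OF h \<open>R > 0\<close> pos]) (auto simp: dist_commute)
    then show "norm ((h z - h w) / (z - w)) * (R - dist w z) \<le> 2 * Re (h w)"
      using z not_sym[of z w] pos_divide_le_eq[of "dist w z" "norm (h z - h w) * (R - dist w z)" "2 * Re (h w)"]
      by (simp add: norm_divide dist_norm norm_minus_commute mult_ac)
  qed
  ultimately have "norm (deriv h w) * (R - dist w w) \<le> 2 * Re (h w)"
    by (intro tendsto_upperbound) auto
  then show ?thesis by simp
qed

text \<open>Adding \<open>M\<close> moves the values of \<open>f\<close> into the right half-plane,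
  with real part less than \<open>2 * M\<close>.\<close>

lemma bounded_holomorphic_deriv_bound:
  assumes f: "f holomorphic_on ball w R" and "R > 0"
    and bd: "\<And>z. z \<in> ball w R \<Longrightarrow> norm (f z) < M"
  shows "norm (deriv f w) * R \<le> 4 * M"
proof -
  have M: "norm (f w) < M" using bd \<open>R > 0\<close> by simp
  have d: "f field_differentiable at w"
    using f \<open>R > 0\<close> holomorphic_on_imp_differentiable_at[OF f open_ball] by simp
  have "norm (deriv (\<lambda>z. of_real M + f z) w) * R \<le> 2 * Re (of_real M + f w)"
  proof (rule half_plane_schwarz_deriv)
    show "(\<lambda>z. of_real M + f z) holomorphic_on ball w R" by (intro holomorphic_intros f)
    show "Re (of_real M + f z) > 0" if "z \<in> ball w R" for z
      using bd[OF that] abs_Re_le_cmod[of "f z"] by simp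
  qed fact
  also have "deriv (\<lambda>z. of_real M + f z) w = deriv f w" using d by simp
  finally show ?thesis using M abs_Re_le_cmod[of "f w"] by simp
qed

lemma bounded_holomorphic_dist_bound:
  assumes f: "f holomorphic_on ball w R" and "R > 0"
    and bd: "\<And>z. z \<in> ball w R \<Longrightarrow> norm (f z) < M" and z: "z \<in> ball w R"
  shows "norm (f z - f w) * (R - dist w z) \<le> 4 * M * dist w z"
proof -
  have pos: "Re (of_real M + f z) > 0" "Re (of_real M + f z) \<le> 2 * M" if "z \<in> ball w R" for z
    using bd[OF that] abs_Re_le_cmod[of "f z"] by (auto simp: abs_le_iff)
  have "norm ((of_real M + f z) - (of_real M + f w)) * (R - dist w z) \<le> 2 * dist w z * Re (of_real M + f w)"
    by (rule half_plane_schwarz[OF _ \<open>R > 0\<close> pos(1) z]) (intro holomorphic_intros f)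
  also have "\<dots> \<le> 2 * dist w z * (2 * M)"
    using pos(2)[of w] \<open>R > 0\<close> by (intro mult_left_mono) auto
  finally show ?thesis by (simp add: mult_ac)
qed

text \<open>The Moebius map of the disc onto the right half-plane that sends \<omega> to infinity.
  Its real part is the Poisson kernel at \<omega>; both the estimate near the frontier and the study
  of fixed points use it as a coordinate.\<close>

definition cayley :: "complex \<Rightarrow> complex \<Rightarrow> complex"
  where "cayley \<omega> z = (\<omega> + z) / (\<omega> - z)"

lemma Re_cayley:
  assumes "norm \<omega> = 1"
  shows "Re (cayley \<omega> z) = (1 - (norm z)\<^sup>2) / (norm (\<omega> - z))\<^sup>2"
proof -
  have "(Re \<omega>)\<^sup>2 + (Im \<omega>)\<^sup>2 = 1" using assms by (simp flip: cmod_power2)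
  then have "Re (\<omega> + z) * Re (\<omega> - z) + Im (\<omega> + z) * Im (\<omega> - z) = 1 - (norm z)\<^sup>2"
    unfolding cmod_power2 by (simp add: power2_eq_square algebra_simps)
  then show ?thesis unfolding cayley_def Re_divide cmod_power2[of "\<omega> - z"] by simp
qed

lemma Re_cayley_pos:
  assumes "norm \<omega> = 1" "norm z < 1"
  shows "Re (cayley \<omega> z) > 0"
proof -
  have "\<omega> \<noteq> z" using assms by auto
  then show ?thesis using assms by (simp add: Re_cayley abs_square_less_1)
qed

lemma holomorphic_cayley:
  assumes "norm \<omega> = 1"
  shows "cayley \<omega> holomorphic_on unit_disc"
  unfolding cayley_def by (intro holomorphic_intros) (use assms in auto)

section \<open>Holomorphic coverings by the disc\<close>

locale disc_cover =
  fixes f :: "complex \<Rightarrow> complex" and D :: "complex set"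
  assumes holo: "f holomorphic_on unit_disc"
    and cover: "covering_space unit_disc f D"
    and openD: "open D"
begin

lemma maps: "z \<in> unit_disc \<Longrightarrow> f z \<in> D"
  using covering_space_imp_surjective[OF cover] by blast

lemma locally_injective:
  assumes "z \<in> unit_disc"
  obtains T where "open T" "z \<in> T" "T \<subseteq> unit_disc" "inj_on f T"
proof -
  obtain T u q where T: "z \<in> T" "openin (top_of_set unit_disc) T" "homeomorphism T u f q"
    using covering_space_local_homeomorphism[OF cover assms] by metis
  then have "open T" "T \<subseteq> unit_disc"
    by (auto simp: openin_open_eq)
  moreover have "inj_on f T"
    using T(3) by (metis homeomorphism_def inj_on_inverseI)
  ultimately show ?thesis using that T by blast
qed

text \<open>Near each point \<open>g\<close> is the composition of \<open>f \<circ> g\<close> with a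
  holomorphic local inverse of \<open>f\<close>, which exists by local injectivity.\<close>

lemma holomorphic_lift:
  assumes "open U" and contg: "continuous_on U g" and gU: "g ` U \<subseteq> unit_disc"
    and fg: "(\<lambda>z. f (g z)) holomorphic_on U"
  shows "g holomorphic_on U"
proof -
  have "g field_differentiable at z" if "z \<in> U" for z
  proof -
    obtain T where T: "open T" "g z \<in> T" "T \<subseteq> unit_disc" "inj_on f T"
      using locally_injective[of "g z"] gU \<open>z \<in> U\<close> by blast
    have holT: "f holomorphic_on T" using holo T holomorphic_on_subset by blast
    obtain k where k: "k holomorphic_on (f ` T)" "\<And>x. x \<in> T \<Longrightarrow> k (f x) = x"
      using holomorphic_has_inverse[OF holT T(1) T(4)] by metis
    have openfT: "open (f ` T)" using open_mapping_thm3[OF holT T(1,4)] .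
    define V where "V = U \<inter> g -` T"
    have "open V" "z \<in> V" unfolding V_def
      using continuous_open_preimage[OF contg \<open>open U\<close> T(1)] \<open>z \<in> U\<close> T by auto
    have "(\<lambda>x. k (f (g x))) holomorphic_on V"
      using holomorphic_on_compose_gen[OF holomorphic_on_subset[OF fg] k(1), of V]
      by (auto simp: o_def V_def)
    then have "g holomorphic_on V"
      by (rule holomorphic_transform) (use k in \<open>auto simp: V_def\<close>)
    then show ?thesis
      using \<open>open V\<close> \<open>z \<in> V\<close> holomorphic_on_imp_differentiable_at by blast
  qed
  then show ?thesis
    using \<open>open U\<close> by (simp add: holomorphic_on_open field_differentiable_def)
qed

lemma lift:
  assumes U: "open U" "simply_connected U" and u: "u holomorphic_on U" "u ` U \<subseteq> D"
    and w: "w \<in> U" and z: "z \<in> unit_disc" "f z = u w"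
  obtains s where "s holomorphic_on U" "s ` U \<subseteq> unit_disc" "s w = z" "\<And>y. y \<in> U \<Longrightarrow> f (s y) = u y"
proof -
  obtain s where s: "continuous_on U s" "s \<in> U \<rightarrow> unit_disc" "s w = z" "\<And>y. y \<in> U \<Longrightarrow> f (s y) = u y"
    using covering_space_lift_strong[OF cover z(1) w U(2) open_imp_locally_path_connected[OF U(1)]
       holomorphic_on_imp_continuous_on[OF u(1)]] u(2) z(2) by (metis Pi_I image_subset_iff)
  have "s holomorphic_on U"
  proof (rule holomorphic_lift[OF U(1) s(1)])
    show "s ` U \<subseteq> unit_disc" using s by blast
    show "(\<lambda>z. f (s z)) holomorphic_on U"
      using u(1) by (rule holomorphic_transform) (use s in auto)
  qed
  then show ?thesis using that s by (metis image_subsetI funcset_mem)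
qed

lemma lift_unique:
  assumes "connected T" "a \<in> T" "x \<in> T" "g1 a = g2 a"
    "continuous_on T g1" "g1 ` T \<subseteq> unit_disc" "continuous_on T g2" "g2 ` T \<subseteq> unit_disc"
    "\<And>x. x \<in> T \<Longrightarrow> f (g1 x) = f (g2 x)"
  shows "g1 x = g2 x"
proof (rule covering_space_lift_unique[OF cover, of g1 a g2 T "\<lambda>x. f (g1 x)"])
  show "continuous_on T (\<lambda>x. f (g1 x))"
    using continuous_on_compose2[OF covering_space_imp_continuous[OF cover] assms(5,6)] .
qed (use assms maps in auto)

lemma section_exists:
  assumes "open U" "simply_connected U" "U \<subseteq> D" "z \<in> unit_disc" "f z \<in> U"
  obtains s where "s holomorphic_on U" "s ` U \<subseteq> unit_disc" "s (f z) = z" "\<And>y. y \<in> U \<Longrightarrow> f (s y) = y"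
  using lift[of U "\<lambda>x. x" "f z" z] assms by (auto simp: holomorphic_on_ident)

text \<open>\<open>f\<close> lifts through itself with \<open>z\<close> sent to \<open>z'\<close>,
  and likewise with \<open>z'\<close> sent to \<open>z\<close>. Each composite of the two lifts is a
  lift of \<open>f\<close> fixing a point, so uniqueness of lifts makes them inverse to each
  other.\<close>

lemma deck_transitive:
  assumes z: "z \<in> unit_disc" "z' \<in> unit_disc" and "f z = f z'"
  obtains g where "g \<in> deck_group f" "g z = z'"
proof -
  have sc: "open unit_disc" "simply_connected unit_disc"
    by (auto simp: convex_imp_simply_connected)
  have im: "f ` unit_disc \<subseteq> D" using maps by blast
  obtain g where g: "g holomorphic_on unit_disc" "g ` unit_disc \<subseteq> unit_disc" "g z = z'"
       "\<And>y. y \<in> unit_disc \<Longrightarrow> f (g y) = f y"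
    using lift[OF sc holo im z(1,2)] assms(3) by metis
  obtain h where h: "h holomorphic_on unit_disc" "h ` unit_disc \<subseteq> unit_disc" "h z' = z"
       "\<And>y. y \<in> unit_disc \<Longrightarrow> f (h y) = f y"
    using lift[OF sc holo im z(2,1)] assms(3) by metis
  have cont: "continuous_on unit_disc g" "continuous_on unit_disc h"
    using g h holomorphic_on_imp_continuous_on by blast+
  have conn: "connected unit_disc" by (rule connected_ball)
  have hg: "h (g x) = x" if "x \<in> unit_disc" for x
    by (rule lift_unique[OF conn z(1) that, of "\<lambda>x. h (g x)" "\<lambda>x. x"])
      (use g h cont in \<open>auto intro!: continuous_on_compose2[OF cont(2) cont(1)] simp: image_subset_iff\<close>)
  have gh: "g (h x) = x" if "x \<in> unit_disc" for x
    by (rule lift_unique[OF conn z(2) that, of "\<lambda>x. g (h x)" "\<lambda>x. x"])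
      (use g h cont in \<open>auto intro!: continuous_on_compose2[OF cont(1) cont(2)] simp: image_subset_iff\<close>)
  \<comment> \<open>Members of \<open>deck_group f\<close> are extensional, so the lift is cut off
    outside the disc.\<close>
  let ?g = "restrict g unit_disc"
  have "homeomorphism unit_disc unit_disc ?g h"
  proof (rule homeomorphismI)
    show "continuous_on unit_disc ?g" using cont(1) by (rule continuous_on_eq) auto
  qed (use cont g h gh hg in \<open>auto simp: image_subset_iff restrict_def\<close>)
  then have "?g \<in> deck_group f"
    unfolding deck_group_def using g by auto
  then show ?thesis using that[of ?g] g z by simp
qed

text \<open>A deck transformation and its inverse are continuous lifts of \<open>f\<close> through
  \<open>f\<close>, hence holomorphic.\<close>

lemma deck_inverse:
  assumes "g \<in> deck_group f"
  shows "\<exists>h. g holomorphic_on unit_disc \<and> h holomorphic_on unit_disc \<and>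
    (\<forall>z\<in>unit_disc. g z \<in> unit_disc \<and> h z \<in> unit_disc \<and> h (g z) = z \<and> g (h z) = z \<and>
      f (g z) = f z \<and> f (h z) = f z)"
proof -
  obtain h where h: "homeomorphism unit_disc unit_disc g h"
    and fg: "\<And>z. z \<in> unit_disc \<Longrightarrow> f (g z) = f z"
    using assms by (auto simp: deck_group_def)
  have im: "g z \<in> unit_disc" "h z \<in> unit_disc" "h (g z) = z" "g (h z) = z" if "z \<in> unit_disc" for z
    using h that unfolding homeomorphism_def by blast+
  have fh: "f (h z) = f z" if "z \<in> unit_disc" for z using fg im that by metis
  have cont: "continuous_on unit_disc g" "continuous_on unit_disc h"
    using h unfolding homeomorphism_def by auto
  have "g holomorphic_on unit_disc" "h holomorphic_on unit_disc"
    by (rule holomorphic_lift; use cont im in \<open>(force intro!: holomorphic_transform[OF holo] simp: fg fh)\<close>)+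
  then show ?thesis using im fg fh by blast
qed

lemma deck_fixed_point_imp_id:
  assumes "g \<in> deck_group f" "z \<in> unit_disc" "g z = z" "x \<in> unit_disc"
  shows "g x = x"
proof -
  have "g holomorphic_on unit_disc" "\<forall>z\<in>unit_disc. g z \<in> unit_disc \<and> f (g z) = f z"
    using deck_inverse[OF assms(1)] by blast+
  then show ?thesis
    by (intro lift_unique[OF connected_ball assms(2,4), of g "\<lambda>x. x"])
      (use assms holomorphic_on_imp_continuous_on in \<open>auto simp: image_subset_iff\<close>)
qed

section \<open>Orbits, fibres and the limit set\<close>

lemma orbit_eq_fiber:
  assumes "z \<in> unit_disc"
  shows "{g z |g. g \<in> deck_group f} = {x \<in> unit_disc. f x = f z}"
proof (intro equalityI subsetI)
  fix x assume "x \<in> {g z |g. g \<in> deck_group f}"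
  then obtain g where "g \<in> deck_group f" "x = g z" by blast
  then show "x \<in> {x \<in> unit_disc. f x = f z}"
    using deck_inverse[of g] assms by blast
next
  fix x assume "x \<in> {x \<in> unit_disc. f x = f z}"
  then obtain g where "g \<in> deck_group f" "g z = x"
    using deck_transitive[of z x] assms by auto
  then show "x \<in> {g z |g. g \<in> deck_group f}" by blast
qed

lemma limit_set_eq: "limit_set (deck_group f) = {\<zeta>. \<exists>z\<in>unit_disc. \<zeta> islimpt {x \<in> unit_disc. f x = f z}}"
  unfolding limit_set_def using orbit_eq_fiber by auto

text \<open>Fibres cannot accumulate inside the disc because \<open>f\<close> is locally
  injective.\<close>

lemma limit_set_subset_circle: "limit_set (deck_group f) \<subseteq> sphere 0 1"
proof
  fix \<zeta> assume "\<zeta> \<in> limit_set (deck_group f)"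
  then obtain z where z: "z \<in> unit_disc" and lim: "\<zeta> islimpt {x \<in> unit_disc. f x = f z}"
    unfolding limit_set_eq by blast
  have "\<zeta> islimpt cball 0 1" using lim by (rule islimpt_subset) auto
  then have "\<zeta> \<in> cball 0 1" using closed_limpt closed_cball by blast
  moreover have "\<zeta> \<notin> unit_disc"
  proof
    assume "\<zeta> \<in> unit_disc"
    then obtain T where T: "open T" "\<zeta> \<in> T" "T \<subseteq> unit_disc" "inj_on f T"
      by (rule locally_injective)
    obtain x where x: "x \<in> T" "x \<noteq> \<zeta>" "x \<in> unit_disc" "f x = f z"
      using islimptE[OF lim T(2,1)] by blast
    \<comment> \<open>Removing \<open>x\<close> leaves a neighbourhood of \<zeta>, which must
      contain a second point of the same fibre.\<close>
    have o: "open (T - {x})" "\<zeta> \<in> T - {x}" using T x by auto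
    then obtain y where y: "y \<in> T - {x}" "y \<noteq> \<zeta>" "f y = f z"
      using islimptE[OF lim o(2,1)] by blast
    then show False using x T(4) by (metis DiffD1 DiffD2 inj_onD singletonI)
  qed
  ultimately show "\<zeta> \<in> sphere 0 1" by auto
qed

text \<open>If the fibre over points of \<open>K\<close> came close to \<open>\<zeta>\<close>, Harnack's inequality for the positive
  harmonic function \<open>1 - Re (\<zeta>\<inverse> s)\<close>, with \<open>s\<close> a local section of \<open>f\<close>, would bring a single orbit close to \<open>\<zeta>\<close>.\<close>
lemma compact_preimage_away_from_regular_point:
  assumes "norm \<zeta> = 1" "\<zeta> \<notin> limit_set (deck_group f)" "compact K" "K \<subseteq> D"
  obtains e where "e > 0" "\<And>z. z \<in> unit_disc \<Longrightarrow> f z \<in> K \<Longrightarrow> dist z \<zeta> \<ge> e"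
proof (rule ccontr)
  note away = that
  assume neg: "\<not> thesis"
  have "\<exists>z. z \<in> unit_disc \<and> f z \<in> K \<and> dist z \<zeta> < e" if "e > 0" for e
  proof (rule ccontr)
    assume "\<not> ?thesis"
    then have "dist z \<zeta> \<ge> e" if "z \<in> unit_disc" "f z \<in> K" for z
      using that by (meson not_le)
    then show False using neg away[OF \<open>e > 0\<close>] by blast
  qed
  then have "\<forall>n. \<exists>z. z \<in> unit_disc \<and> f z \<in> K \<and> dist z \<zeta> < 1 / real (Suc n)" by simp
  then obtain z where z: "\<And>n. z n \<in> unit_disc" "\<And>n. f (z n) \<in> K" "\<And>n. dist (z n) \<zeta> < 1 / real (Suc n)"
    by metis
  \<comment> \<open>The images subconverge to some \<open>w\<close> in the compact set
    \<open>K\<close>; the fibre over this \<open>w\<close> will be seen to accumulate at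
    \<zeta>.\<close>
  obtain w r where w: "w \<in> K" and r: "strict_mono r" and lim: "(\<lambda>n. f (z (r n))) \<longlonglongrightarrow> w"
    using \<open>compact K\<close> z(2) unfolding compact_def o_def by meson
  obtain d where d: "d > 0" "ball w d \<subseteq> D" using openD w assms(4) open_contains_ball by blast
  obtain z0 where z0: "z0 \<in> unit_disc" "f z0 = w"
    using w assms(4) covering_space_imp_surjective[OF cover] by blast
  have key: "\<exists>x\<in>unit_disc. f x = w \<and> dist x \<zeta> < e" if "e > 0" for e
  proof -
    have "\<forall>\<^sub>F n in sequentially. dist (f (z (r n))) w < d/4"
      using tendstoD[OF lim, of "d/4"] d by simp
    moreover have "(\<lambda>n. 1 / real (Suc n)) \<longlonglongrightarrow> 0"
      using LIMSEQ_inverse_real_of_nat by (simp add: inverse_eq_divide)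
    then have "\<forall>\<^sub>F n in sequentially. 1 / real (Suc n) < e/3"
      using \<open>e > 0\<close> by (intro order_tendstoD) auto
    ultimately have "\<forall>\<^sub>F n in sequentially. dist (f (z (r n))) w < d/4 \<and> 1 / real (Suc n) < e/3"
      by (rule eventually_conj)
    then obtain n where n: "dist (f (z (r n))) w < d/4" "1 / real (Suc n) < e/3"
      by (auto simp: eventually_sequentially)
    define y where "y = z (r n)"
    have y: "y \<in> unit_disc" using z(1) by (simp add: y_def)
    have "dist y \<zeta> < 1 / real (Suc (r n))" using z(3) by (simp add: y_def)
    also have "\<dots> \<le> 1 / real (Suc n)" using seq_suble[OF r, of n] by (simp add: frac_le)
    finally have ye: "dist y \<zeta> < e/3" using n by simp
    obtain s where s: "s holomorphic_on ball w d" "s ` ball w d \<subseteq> unit_disc" "s (f y) = y"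
        "\<And>x. x \<in> ball w d \<Longrightarrow> f (s x) = x"
    proof -
      have "simply_connected (ball w d)" by (simp add: convex_imp_simply_connected)
      moreover have "f y \<in> ball w d" using n(1) d by (simp add: y_def dist_commute)
      ultimately show ?thesis using section_exists[OF open_ball _ d(2) y] that by blast
    qed
    \<comment> \<open>Its values lie in the right half-plane because \<open>norm \<zeta> = 1\<close>
      and \<open>s\<close> maps into the disc; its norm is the distance of \<open>s x\<close> from
      \<zeta>.\<close>
    let ?h = "\<lambda>x. 1 - cnj \<zeta> * s x"
    have sub: "ball (f y) (d/2) \<subseteq> ball w d"
      proof
      fix x assume "x \<in> ball (f y) (d/2)"
      then show "x \<in> ball w d"
        using n(1) d dist_triangle[of w x "f y"] by (simp add: y_def dist_commute)
    qed
    have hpos: "Re (?h x) > 0" if "x \<in> ball (f y) (d/2)" for x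
    proof -
      have "s x \<in> unit_disc" using s(2) sub that by blast
      then have "norm (cnj \<zeta> * s x) < 1" using assms(1) by (simp add: norm_mult)
      then have "Re (cnj \<zeta> * s x) < 1" using complex_Re_le_cmod[of "cnj \<zeta> * s x"] by linarith
        then show ?thesis by simp
    qed
    have "norm (?h w - ?h (f y)) * (d/2 - dist (f y) w) \<le> 2 * dist (f y) w * Re (?h (f y))"
    proof (rule half_plane_schwarz)
      show "?h holomorphic_on ball (f y) (d/2)"
        by (intro holomorphic_intros holomorphic_on_subset[OF s(1) sub])
      show "Re (?h x) > 0" if "x \<in> ball (f y) (d/2)" for x
        using hpos[OF that] .
      show "w \<in> ball (f y) (d/2)" using n(1) d by (simp add: y_def)
    qed (use d in auto)
    also have "\<dots> \<le> 2 * (d/4) * norm (?h (f y))"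
      using n(1) d complex_Re_le_cmod[of "?h (f y)"] hpos[of "f y"]
      by (intro mult_mono) (auto simp: y_def simp del: minus_complex.simps times_complex.simps)
    finally have *: "norm (?h w - ?h (f y)) * (d/2 - dist (f y) w) \<le> norm (?h (f y)) * (d/2)" by (simp add: mult_ac)
    \<comment> \<open>Since \<open>w\<close> is within \<open>d/4\<close> of the centre
      \<open>f y\<close> of a ball of radius \<open>d/2\<close>, Harnack's inequality gives the
      factor 2, and the triangle inequality then the factor 3 for which \<open>e/3\<close> was
      chosen.\<close>
    have "norm (?h w - ?h (f y)) * (d/4) \<le> norm (?h w - ?h (f y)) * (d/2 - dist (f y) w)"
      using n(1) by (intro mult_left_mono) (auto simp: y_def)
    with * have "norm (?h w - ?h (f y)) * (d/4) \<le> norm (?h (f y)) * (d/2)" by linarith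
    then have le2: "norm (?h w - ?h (f y)) \<le> 2 * norm (?h (f y))" using d by simp
    have cc: "cnj \<zeta> * \<zeta> = 1" using assms(1) by (metis complex_norm_square mult.commute of_real_1 one_power2)
    have hs: "norm (?h x) = dist (s x) \<zeta>" for x
    proof -
      have "?h x = cnj \<zeta> * (\<zeta> - s x)" using cc by (simp add: algebra_simps)
      then show ?thesis using assms(1) by (simp add: norm_mult dist_norm norm_minus_commute)
    qed
    have "dist (s w) \<zeta> \<le> 3 * dist y \<zeta>"
      using le2 hs[of w] hs[of "f y"] norm_triangle_sub[of "?h w" "?h (f y)"] s(3) by simp
    then have "dist (s w) \<zeta> < e" using ye by simp
    moreover have "w \<in> ball w d" using d by simp
    then have "s w \<in> unit_disc" "f (s w) = w" using s(2,4) by blast+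
    ultimately show ?thesis by blast
  qed
  have "\<zeta> islimpt {x \<in> unit_disc. f x = f z0}"
    unfolding islimpt_approachable
  proof (intro allI impI)
    fix e :: real assume "e > 0"
    then obtain x where "x \<in> unit_disc" "f x = w" "dist x \<zeta> < e" using key by blast
    moreover have "x \<noteq> \<zeta>" using \<open>x \<in> unit_disc\<close> assms(1) by auto
    ultimately show "\<exists>x'\<in>{x \<in> unit_disc. f x = f z0}. x' \<noteq> \<zeta> \<and> dist x' \<zeta> < e" using z0 by auto
  qed
  then have "\<zeta> \<in> limit_set (deck_group f)" unfolding limit_set_eq using z0 by blast
  then show False using assms by blast
qed

end

section \<open>Smooth curves as Lipschitz graphs\<close>

text \<open>The affine coordinate \<zeta> turns and rescales the plane about \<open>p\<close>; for a
  smooth curve \<open>v\<close> is a tangent vector. The function \<phi> is total, so that no domain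
  has to be carried along; the radius \<open>r\<close> says where it describes
  \<open>F\<close>.\<close>

definition graph_at :: "complex set \<Rightarrow> complex \<Rightarrow> complex \<Rightarrow> (real \<Rightarrow> real) \<Rightarrow> real \<Rightarrow> bool" where
  "graph_at F p v \<phi> r \<longleftrightarrow> v \<noteq> 0 \<and> r > 0 \<and> \<phi> 0 = 0 \<and> (\<forall>x y. \<bar>\<phi> x - \<phi> y\<bar> \<le> \<bar>x - y\<bar>) \<and>
     (\<forall>\<zeta>. norm \<zeta> < r \<longrightarrow> (p + v * \<zeta> \<in> F \<longleftrightarrow> Im \<zeta> = \<phi> (Re \<zeta>)))"

lemma periodic_int:
  fixes \<gamma> :: "real \<Rightarrow> 'a"
  assumes "\<And>t. \<gamma> (t + 1) = \<gamma> t"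
  shows "\<gamma> (t + of_int n) = \<gamma> t"
proof -
  have *: "\<gamma> (t + real m) = \<gamma> t" for m t
  proof (induction m)
    case (Suc m)
    have "\<gamma> (t + real (Suc m)) = \<gamma> (t + real m + 1)" by (simp add: algebra_simps)
    then show ?case using Suc assms by simp
  qed simp
  show ?thesis
  proof (cases "n \<ge> 0")
    case True
    then show ?thesis using *[of t "nat n"] by simp
  next
    case False
    then show ?thesis using *[of "t + of_int n" "nat (- n)"] by simp
  qed
qed

text \<open>By periodicity the curve is the image of the compact interval
  \<open>{0..1}\<close>.\<close>

lemma smooth_closed_curve_closed:
  assumes "smooth_closed_curve C"
  shows "closed C"
proof -
  obtain \<gamma> where g: "smooth_curve \<gamma>" "\<And>t. \<gamma> (t + 1) = \<gamma> t" "C = range \<gamma>"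
    using assms by (auto simp: smooth_closed_curve_def)
  have "\<gamma> differentiable (at t)" for t
    using g(1) unfolding smooth_curve_def by (metis funpow_0)
  then have "continuous_on {0..1} \<gamma>"
    by (meson continuous_at_imp_continuous_on differentiable_imp_continuous_within)
  then have "compact (\<gamma> ` {0..1})" by (intro compact_continuous_image) auto
  moreover have "range \<gamma> = \<gamma> ` {0..1}"
  proof (intro equalityI subsetI)
    fix x assume "x \<in> range \<gamma>"
    then obtain t where "x = \<gamma> t" by blast
    then have "x = \<gamma> (t + of_int (- \<lfloor>t\<rfloor>))" using periodic_int[of \<gamma>, OF g(2)] by metis
    moreover have "t + of_int (- \<lfloor>t\<rfloor>) \<in> {0..1}" by simp linarith
    ultimately show "x \<in> \<gamma> ` {0..1}" by blast
  qed auto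
  ultimately show ?thesis using g(3) compact_imp_closed by simp
qed

text \<open>The real part of \<open>h\<close> increases with slopes between 3/4 and 5/4, so it can
  serve as the parameter; the imaginary part has slopes at most 1/4. Their quotient stays below
  1.\<close>

lemma graph_of_near_identity:
  fixes h :: "real \<Rightarrow> complex"
  assumes "\<eta> > 0" "h t0 = 0" and conth: "continuous_on {t0-\<eta>..t0+\<eta>} h"
    and near: "\<And>s t. s \<in> {t0-\<eta>..t0+\<eta>} \<Longrightarrow> t \<in> {t0-\<eta>..t0+\<eta>} \<Longrightarrow>
      norm ((h t - h s) - of_real (t - s)) \<le> \<bar>t - s\<bar> / 4"
  obtains \<phi> where "\<phi> 0 = 0" "\<And>x y. \<bar>\<phi> x - \<phi> y\<bar> \<le> \<bar>x - y\<bar>"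
    "\<And>\<zeta>. norm \<zeta> < 3/4 * \<eta> \<Longrightarrow> \<zeta> \<in> h ` {t0-\<eta>..t0+\<eta>} \<longleftrightarrow> Im \<zeta> = \<phi> (Re \<zeta>)"
proof -
  define I where "I = {t0-\<eta>..t0+\<eta>}"
  \<comment> \<open>At the ends of the interval the real part of \<open>h\<close> has moved from 0
    by at least \<open>3/4 * \<eta>\<close>, so it takes every value in
    \<open>{-b..b}\<close>.\<close>
  define b where "b = 3/4 * \<eta>"
  have b: "b > 0" using \<open>\<eta> > 0\<close> by (simp add: b_def)
  have X: "\<bar>Re (h t) - Re (h s) - (t - s)\<bar> \<le> \<bar>t - s\<bar> / 4" "\<bar>Im (h t) - Im (h s)\<bar> \<le> \<bar>t - s\<bar> / 4"
    if "s \<in> I" "t \<in> I" for s t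
    using near[of s t] that abs_Re_le_cmod[of "(h t - h s) - of_real (t - s)"]
      abs_Im_le_cmod[of "(h t - h s) - of_real (t - s)"] by (auto simp: I_def)
  have t0: "t0 \<in> I" "t0 + \<eta> \<in> I" "t0 - \<eta> \<in> I" using \<open>\<eta> > 0\<close> by (auto simp: I_def)
  have "\<exists>t\<in>I. Re (h t) = x" if "\<bar>x\<bar> \<le> b" for x
  proof -
    have "\<exists>t. t0 - \<eta> \<le> t \<and> t \<le> t0 + \<eta> \<and> Re (h t) = x"
    proof (rule IVT')
      have "Re (h (t0 - \<eta>)) + \<eta> \<le> \<eta> / 4"
        using abs_le_D1[OF X(1)[OF t0(1,3)]] \<open>\<eta> > 0\<close> \<open>h t0 = 0\<close> by simp
      moreover have "- x \<le> 3/4 * \<eta>" using that by (simp add: b_def abs_le_iff)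
      ultimately show "Re (h (t0 - \<eta>)) \<le> x" by simp
      show "x \<le> Re (h (t0 + \<eta>))"
        using abs_le_D2[OF X(1)[OF t0(1,2)]] that \<open>\<eta> > 0\<close> \<open>h t0 = 0\<close> by (simp add: b_def)
      show "continuous_on {t0-\<eta>..t0+\<eta>} (\<lambda>t. Re (h t))" by (intro continuous_intros conth)
    qed (use \<open>\<eta> > 0\<close> in auto)
    then show ?thesis by (auto simp: I_def)
  qed
  then obtain \<tau> where \<tau>: "\<And>x. \<bar>x\<bar> \<le> b \<Longrightarrow> \<tau> x \<in> I" "\<And>x. \<bar>x\<bar> \<le> b \<Longrightarrow> Re (h (\<tau> x)) = x"
    by metis
  have \<tau>_eq: "\<tau> (Re (h t)) = t" if "t \<in> I" "\<bar>Re (h t)\<bar> \<le> b" for t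
    using X(1)[OF that(1) \<tau>(1)[OF that(2)]] \<tau>(2)[OF that(2)] by (simp add: abs_if split: if_splits)
  \<comment> \<open>Clamping to \<open>{-b..b}\<close> extends \<phi> to the whole line without
    increasing its slopes.\<close>
  define c where "c = (\<lambda>x. max (- b) (min b x))"
  have c: "\<bar>c x\<bar> \<le> b" "\<bar>c x - c y\<bar> \<le> \<bar>x - y\<bar>" for x y using b by (auto simp: c_def)
  have c_id: "c x = x" if "\<bar>x\<bar> \<le> b" for x using that by (auto simp: c_def)
  define \<phi> where "\<phi> = (\<lambda>x. Im (h (\<tau> (c x))))"
  show thesis
  proof
    show "\<phi> 0 = 0"
      using \<tau>_eq[OF t0(1)] b \<open>h t0 = 0\<close> by (simp add: \<phi>_def c_id)
    show "\<bar>\<phi> x - \<phi> y\<bar> \<le> \<bar>x - y\<bar>" for x y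
    proof -
      note I = \<tau>(1)[OF c(1)[of y]] \<tau>(1)[OF c(1)[of x]]
      have *: "\<bar>d\<bar> / 4 \<le> \<bar>u\<bar>" if "\<bar>u - d\<bar> \<le> \<bar>d\<bar> / 4" for u d :: real
        using that by (auto simp: abs_if split: if_splits)
      have "\<bar>\<phi> x - \<phi> y\<bar> \<le> \<bar>\<tau> (c x) - \<tau> (c y)\<bar> / 4"
        using X(2)[OF I] by (simp add: \<phi>_def)
      also have "\<dots> \<le> \<bar>c x - c y\<bar>"
        using *[OF X(1)[OF I]] \<tau>(2)[OF c(1)[of x]] \<tau>(2)[OF c(1)[of y]] by simp
      also have "\<dots> \<le> \<bar>x - y\<bar>" by (rule c)
      finally show ?thesis .
    qed
        fix \<zeta> :: complex assume "norm \<zeta> < 3/4 * \<eta>"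
    then have R: "\<bar>Re \<zeta>\<bar> \<le> b" using abs_Re_le_cmod[of \<zeta>] by (simp add: b_def)
    show "\<zeta> \<in> h ` {t0-\<eta>..t0+\<eta>} \<longleftrightarrow> Im \<zeta> = \<phi> (Re \<zeta>)"
    proof
      assume "\<zeta> \<in> h ` {t0-\<eta>..t0+\<eta>}"
      then obtain t where "t \<in> I" "\<zeta> = h t" by (auto simp: I_def)
      then show "Im \<zeta> = \<phi> (Re \<zeta>)" using \<tau>_eq R by (simp add: \<phi>_def c_id)
    next
      assume "Im \<zeta> = \<phi> (Re \<zeta>)"
      then have "h (\<tau> (Re \<zeta>)) = \<zeta>" using \<tau>(2)[OF R] R by (simp add: \<phi>_def c_id complex_eq_iff)
      then show "\<zeta> \<in> h ` {t0-\<eta>..t0+\<eta>}" using \<tau>(1)[OF R] unfolding I_def by (metis imageI)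
    qed
  qed
qed

text \<open>Divided by the derivative \<open>v\<close> at \<open>t0\<close>, the curve is close to a
  unit-speed real parametrisation near \<open>t0\<close>. The rest of one period is compact and
  avoids \<open>p\<close> by injectivity, so it stays out of a small disc about
  \<open>p\<close>.\<close>

lemma smooth_closed_curve_graph_at:
  assumes "smooth_closed_curve C" "p \<in> C"
  obtains v \<phi> r where "graph_at C p v \<phi> r"
proof -
  obtain \<gamma> where g: "smooth_curve \<gamma>" "\<And>t. \<gamma> (t + 1) = \<gamma> t"
    "\<And>t. vector_derivative \<gamma> (at t) \<noteq> 0" "inj_on \<gamma> {0..<1}" "C = range \<gamma>"
    using assms by (auto simp: smooth_closed_curve_def)
  obtain t0 where p: "p = \<gamma> t0" using assms g by blast
  define v where "v = vector_derivative \<gamma> (at t0)"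
  have v: "v \<noteq> 0" using g by (simp add: v_def)
  have d0: "(\<gamma> has_vector_derivative vector_derivative \<gamma> (at t)) (at t)" for t
    using g(1) unfolding smooth_curve_def by (metis funpow_0 vector_derivative_works)
  have "(\<lambda>s. vector_derivative \<gamma> (at s)) differentiable (at t0)"
    using g(1)[unfolded smooth_curve_def, rule_format, of 1 t0] by simp
  then have "isCont (\<lambda>s. vector_derivative \<gamma> (at s)) t0"
    by (rule differentiable_imp_continuous_within)
  then have "isCont (\<lambda>s. vector_derivative \<gamma> (at s) / v) t0"
    by (intro continuous_intros) (use v in auto)
  then obtain \<eta>' where \<eta>': "\<eta>' > 0" "\<And>s. dist s t0 < \<eta>' \<Longrightarrow>
      dist (vector_derivative \<gamma> (at s) / v) (vector_derivative \<gamma> (at t0) / v) < 1/4"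
    unfolding continuous_at_eps_delta by (metis zero_less_divide_1_iff zero_less_numeral)
  \<comment> \<open>The bound 1/4 keeps the interval inside the period of length 1 centred at
    \<open>t0\<close>.\<close>
  define \<eta> where "\<eta> = min (\<eta>'/2) (1/4)"
  have \<eta>: "\<eta> > 0" "\<eta> < 1/2" "\<eta> < \<eta>'" using \<eta>' by (auto simp: \<eta>_def)
  define h where "h = (\<lambda>t. (\<gamma> t - p) / v)"
  have dh: "(h has_vector_derivative vector_derivative \<gamma> (at t) / v) (at t within S)" for t S
  proof -
    have "((\<lambda>t. (\<gamma> t - p) * inverse v) has_vector_derivative (vector_derivative \<gamma> (at t) - 0) * inverse v) (at t)"
      by (intro has_vector_derivative_mult_left has_vector_derivative_diff d0 has_vector_derivative_const)
    then show ?thesis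
      unfolding h_def divide_inverse using has_vector_derivative_at_within by simp
  qed
  have conth: "continuous_on S h" for S
    using dh by (meson continuous_on_vector_derivative)
  have near: "norm ((h t - h s) - of_real (t - s)) \<le> \<bar>t - s\<bar> / 4"
    if "s \<in> {t0-\<eta>..t0+\<eta>}" "t \<in> {t0-\<eta>..t0+\<eta>}" for s t
  proof -
    have "norm (h t - h s - (t - s) *\<^sub>R (vector_derivative \<gamma> (at t0) / v)) \<le> norm (t - s) * (1/4)"
    proof (rule vector_differentiable_bound_linearization)
      show "closed_segment s t \<subseteq> {t0-\<eta>..t0+\<eta>}" using that by (simp add: closed_segment_subset)
      show "norm (vector_derivative \<gamma> (at x) / v - vector_derivative \<gamma> (at t0) / v) \<le> 1/4"
        if "x \<in> {t0-\<eta>..t0+\<eta>}" for x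
      proof -
        have "dist x t0 < \<eta>'" using that \<eta> by (auto simp: dist_real_def abs_less_iff)
        then show ?thesis using \<eta>'(2)[of x] by (simp add: dist_norm)
      qed
    qed (use dh \<eta> in auto)
    then show ?thesis using v by (simp add: v_def[symmetric] scaleR_conv_of_real)
  qed
  have h0: "h t0 = 0" by (simp add: h_def p)
  obtain \<phi> where \<phi>: "\<phi> 0 = 0" "\<And>x y. \<bar>\<phi> x - \<phi> y\<bar> \<le> \<bar>x - y\<bar>"
    "\<And>\<zeta>. norm \<zeta> < 3/4 * \<eta> \<Longrightarrow> \<zeta> \<in> h ` {t0-\<eta>..t0+\<eta>} \<longleftrightarrow> Im \<zeta> = \<phi> (Re \<zeta>)"
    using graph_of_near_identity[OF \<eta>(1) h0 conth near] by metis
  define J where "J = {t0-1/2..t0-\<eta>} \<union> {t0+\<eta>..t0+1/2}"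
  have "compact (h ` J)" by (intro compact_continuous_image conth) (auto simp: J_def)
  moreover have "0 \<notin> h ` J"
  proof
    assume "0 \<in> h ` J"
    then obtain t where t: "t \<in> J" "\<gamma> t = \<gamma> t0" using v by (auto simp: h_def p)
    \<comment> \<open>Both parameters are reduced to \<open>{0..<1}\<close>, where \<gamma> is
      injective; hence they differ by an integer, which has modulus at most 1/2.\<close>
    have "\<gamma> (t + of_int (- \<lfloor>t\<rfloor>)) = \<gamma> (t0 + of_int (- \<lfloor>t0\<rfloor>))"
      using t periodic_int[of \<gamma>, OF g(2)] by metis
    moreover have "t + of_int (- \<lfloor>t\<rfloor>) \<in> {0..<1}" "t0 + of_int (- \<lfloor>t0\<rfloor>) \<in> {0..<1}" 
      by (simp; linarith)+
    ultimately have "t + of_int (- \<lfloor>t\<rfloor>) = t0 + of_int (- \<lfloor>t0\<rfloor>)"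
      using g(4) by (meson inj_onD)
    moreover define m where "m = \<lfloor>t\<rfloor> - \<lfloor>t0\<rfloor>"
    ultimately have e: "t - t0 = of_int m" by simp
    have "\<bar>t - t0\<bar> \<le> 1/2" "t \<noteq> t0" using t(1) \<eta> by (auto simp: J_def)
    have "\<bar>real_of_int m\<bar> < 1" using e \<open>\<bar>t - t0\<bar> \<le> 1/2\<close> by simp
    then have "m = 0" by linarith
    then show False using e \<open>t \<noteq> t0\<close> by simp
  qed
  ultimately obtain d where d: "d > 0" "\<And>y. y \<in> h ` J \<Longrightarrow> d \<le> dist 0 y"
    using separate_point_closed[of "h ` J" 0] compact_imp_closed by blast
  have "graph_at C p v \<phi> (min (3/4 * \<eta>) d)"
    unfolding graph_at_def
  proof (intro conjI allI impI)
    fix \<zeta> :: complex assume z: "norm \<zeta> < min (3/4 * \<eta>) d"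
    have "p + v * \<zeta> \<in> C \<longleftrightarrow> \<zeta> \<in> h ` {t0-\<eta>..t0+\<eta>}"
    proof
      assume "p + v * \<zeta> \<in> C"
      then obtain t' where t': "p + v * \<zeta> = \<gamma> t'" using g by blast
      \<comment> \<open>Shift of the parameter into the period centred at \<open>t0\<close>.\<close>
      define t where "t = t' + of_int (- \<lfloor>t' - t0 + 1/2\<rfloor>)"
      have t: "\<gamma> t = \<gamma> t'" unfolding t_def by (rule periodic_int[of \<gamma>, OF g(2)])
      have "t0 - 1/2 \<le> t" "t \<le> t0 + 1/2" unfolding t_def by linarith+
      then have "t \<in> J \<or> t \<in> {t0-\<eta>..t0+\<eta>}" by (auto simp: J_def)
      moreover have "h t = (p + v * \<zeta> - p) / v" unfolding h_def t t' ..
      then have "h t = \<zeta>" using v by simp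
      ultimately show "\<zeta> \<in> h ` {t0-\<eta>..t0+\<eta>}" using d(2)[of \<zeta>] z by auto
    next
      assume "\<zeta> \<in> h ` {t0-\<eta>..t0+\<eta>}"
      then obtain t where "\<zeta> = h t" by blast
      then have "p + v * \<zeta> = \<gamma> t" using v by (simp add: h_def)
      then show "p + v * \<zeta> \<in> C" using g by simp
    qed
    then show "p + v * \<zeta> \<in> C \<longleftrightarrow> Im \<zeta> = \<phi> (Re \<zeta>)" using \<phi>(3)[of \<zeta>] z by simp
  qed (use v \<eta> d \<phi> in auto)
  then show ?thesis using that by blast
qed

text \<open>The other curves form a closed set missing \<open>p\<close>, so shrinking the radius
  leaves only the curve through \<open>p\<close>. Division by \<open>norm v\<close> converts a
  distance in the plane into one in the coordinate \<zeta>.\<close>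

lemma disjoint_curves_graph_at:
  assumes "finite I" "\<And>i. i \<in> I \<Longrightarrow> smooth_closed_curve (C i)" "disjoint_family_on C I"
    and p: "p \<in> (\<Union>i\<in>I. C i)"
  obtains v \<phi> r where "graph_at (\<Union>i\<in>I. C i) p v \<phi> r"
proof -
  obtain i where i: "i \<in> I" "p \<in> C i" using p by blast
  obtain v \<phi> r where g: "graph_at (C i) p v \<phi> r"
    using smooth_closed_curve_graph_at[OF assms(2)[OF i(1)] i(2)] by blast
  have v: "v \<noteq> 0" and r: "r > 0" using g by (auto simp: graph_at_def)
  define R where "R = (\<Union>j\<in>I - {i}. C j)"
  have "closed R" unfolding R_def using assms smooth_closed_curve_closed by (intro closed_UN) auto
  moreover have "p \<notin> R" using i assms(3) unfolding R_def disjoint_family_on_def by blast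
  ultimately obtain e where e: "e > 0" "\<And>y. y \<in> R \<Longrightarrow> e \<le> dist p y"
    using separate_point_closed[of R p] by blast
  have "graph_at (\<Union>i\<in>I. C i) p v \<phi> (min r (e / norm v))"
    unfolding graph_at_def
  proof (intro conjI allI impI)
    fix \<zeta> :: complex assume z: "norm \<zeta> < min r (e / norm v)"
    then have "norm (v * \<zeta>) < e" using v by (simp add: norm_mult field_simps)
    then have "p + v * \<zeta> \<notin> R" using e(2)[of "p + v * \<zeta>"] by (auto simp: dist_norm)
    then have "p + v * \<zeta> \<in> (\<Union>i\<in>I. C i) \<longleftrightarrow> p + v * \<zeta> \<in> C i" using i unfolding R_def by blast
    then show "p + v * \<zeta> \<in> (\<Union>i\<in>I. C i) \<longleftrightarrow> Im \<zeta> = \<phi> (Re \<zeta>)"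
      using g z by (simp add: graph_at_def)
  qed (use g v e in \<open>auto simp: graph_at_def\<close>)
  then show ?thesis using that by blast
qed

section \<open>Domains bounded by Lipschitz graphs\<close>

text \<open>Over \<open>\<bar>x\<bar> < a\<close> a graph through 0 with slopes at most 1 stays
  below height \<open>a\<close>; the lid at \<open>3 * a\<close> leaves room for a star centre at
  height \<open>2 * a\<close>.\<close>

definition upper_box :: "(real \<Rightarrow> real) \<Rightarrow> real \<Rightarrow> complex set" where
  "upper_box \<phi> a = {\<zeta>. \<bar>Re \<zeta>\<bar> < a \<and> \<phi> (Re \<zeta>) < Im \<zeta> \<and> Im \<zeta> < 3 * a}"

locale graph_fun =
  fixes \<phi> :: "real \<Rightarrow> real" and a :: real
  assumes lip: "\<bar>\<phi> x - \<phi> y\<bar> \<le> \<bar>x - y\<bar>" and zero: "\<phi> 0 = 0" and a: "a > 0"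
begin

lemma le_abs: "\<phi> x \<le> \<bar>x\<bar>" "- \<bar>x\<bar> \<le> \<phi> x"
  using lip[of x 0] zero by (auto simp: abs_le_iff)

lemma open_upper_box: "open (upper_box \<phi> a)"
proof -
  have "1-lipschitz_on UNIV \<phi>" using lip by (auto intro!: lipschitz_onI simp: dist_real_def)
  then have "continuous_on UNIV \<phi>" by (rule lipschitz_on_continuous_on)
  then have *: "continuous_on UNIV (\<lambda>\<zeta>. \<phi> (Re \<zeta>))"
    by (rule continuous_on_compose2) (auto intro: continuous_intros)
  show ?thesis
    unfolding upper_box_def by (intro open_Collect_conj open_Collect_less *) (auto intro!: continuous_intros)
qed

text \<open>From a point at height at most \<open>a\<close> the segment to the centre gains at least
  as much height as it moves sideways, while the graph rises with slope at most 1.\<close>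

lemma starlike_upper_box: "starlike (upper_box \<phi> a)"
  unfolding starlike_def
proof (intro bexI[of _ "Complex 0 (2 * a)"] ballI subsetI)
  show "Complex 0 (2 * a) \<in> upper_box \<phi> a" using a zero by (simp add: upper_box_def)
next
  fix \<zeta> w assume z: "\<zeta> \<in> upper_box \<phi> a" and "w \<in> closed_segment (Complex 0 (2 * a)) \<zeta>"
  then obtain u where u: "0 \<le> u" "u \<le> 1" "w = (1 - u) *\<^sub>R Complex 0 (2 * a) + u *\<^sub>R \<zeta>"
    by (auto simp: in_segment)
  define x y where "x = Re \<zeta>" "y = Im \<zeta>"
  have xy: "\<bar>x\<bar> < a" "\<phi> x < y" "y < 3 * a" using z by (auto simp: upper_box_def x_y_def)
  have w: "Re w = u * x" "Im w = (1 - u) * (2 * a) + u * y" using u by (auto simp: x_y_def)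
  have ux: "\<bar>u * x\<bar> \<le> \<bar>x\<bar>" using u by (simp add: abs_mult mult_left_le_one_le)
  have "Im w < 3 * a"
  proof (cases "u = 0")
    case False
    have "(1 - u) * (2 * a) + u * y < (1 - u) * (3 * a) + u * (3 * a)"
      using u a xy False by (intro add_le_less_mono mult_left_mono mult_strict_left_mono) auto
    then show ?thesis using w by (simp add: algebra_simps)
  qed (use w a in simp)
  moreover have "\<phi> (Re w) < Im w"
  \<comment> \<open>A low point is treated by this comparison of slopes; from a point above height
    \<open>a\<close> the whole segment stays above \<open>a\<close>, hence above the graph.\<close>
  proof (cases "y \<le> a")
    case True
    have "\<phi> (u * x) \<le> \<phi> x + \<bar>u * x - x\<bar>" using abs_le_D1[OF lip[of "u * x" x]] by linarith
    also have "\<bar>u * x - x\<bar> = (1 - u) * \<bar>x\<bar>"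
      using u abs_mult[of "1 - u" x] by (simp add: algebra_simps abs_minus_commute)
    also have "\<phi> x + (1 - u) * \<bar>x\<bar> < y + (1 - u) * (2 * a - y)"
      using u xy True by (intro add_less_le_mono mult_left_mono) auto
    finally show ?thesis using w by (simp add: algebra_simps)
  next
    case False
    have "\<phi> (u * x) < a" using le_abs(1)[of "u * x"] ux xy by linarith
    also have "a \<le> (1 - u) * (2 * a) + u * y"
    proof -
      have "(1 - u) * a + u * a \<le> (1 - u) * (2 * a) + u * y"
        using u a False by (intro add_mono mult_left_mono) auto
      then show ?thesis by (simp add: algebra_simps)
    qed
    finally show ?thesis using w by simp
  qed
  ultimately show "w \<in> upper_box \<phi> a" using ux xy w by (auto simp: upper_box_def)
qed

lemma norm_upper_box:
  assumes "\<zeta> \<in> upper_box \<phi> a"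
  shows "norm \<zeta> < 4 * a"
proof -
  have "\<bar>Re \<zeta>\<bar> < a" "\<bar>Im \<zeta>\<bar> < 3 * a"
    using assms le_abs(2)[of "Re \<zeta>"] by (auto simp: upper_box_def)
  then show ?thesis using cmod_le[of \<zeta>] by linarith
qed

text \<open>Moving each coordinate by less than half the height above the graph changes that height
  by less than itself, as the slopes of \<phi> are at most 1.\<close>

lemma ball_subset_upper_box:
  assumes "\<bar>Re \<xi>\<bar> \<le> a/4" "Im \<xi> \<le> 5/4 * a"
  shows "ball \<xi> ((Im \<xi> - \<phi> (Re \<xi>)) / 2) \<subseteq> upper_box \<phi> a"
proof
  fix w assume w: "w \<in> ball \<xi> ((Im \<xi> - \<phi> (Re \<xi>)) / 2)"
  define t where "t = (Im \<xi> - \<phi> (Re \<xi>)) / 2"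
  have t_eq: "2 * t = Im \<xi> - \<phi> (Re \<xi>)" by (simp add: t_def)
  have "norm (w - \<xi>) < t" using w by (simp add: dist_norm norm_minus_commute t_def)
  then have d: "\<bar>Re w - Re \<xi>\<bar> < t" "\<bar>Im w - Im \<xi>\<bar> < t"
    using abs_Re_le_cmod[of "w - \<xi>"] abs_Im_le_cmod[of "w - \<xi>"] by auto
  have "2 * t \<le> 3/2 * a" using le_abs(2)[of "Re \<xi>"] assms t_eq by linarith
  then have "\<bar>Re w\<bar> < a" "Im w < 3 * a" using d assms a by linarith+
  moreover have "\<phi> (Re w) < Im w" using d abs_le_D1[OF lip[of "Re w" "Re \<xi>"]] t_eq by linarith
  ultimately show "w \<in> upper_box \<phi> a" by (simp add: upper_box_def)
qed

end

lemma graph_at_graph_fun: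
  assumes "graph_at F p v \<phi> r"
  shows "graph_fun \<phi> (r/4)"
  using assms by unfold_locales (auto simp: graph_at_def)

text \<open>The lower side of the graph is the upper side in the coordinates turned by half a turn.\<close>
lemma graph_at_reflect:
  assumes "graph_at F p v \<phi> r"
  shows "graph_at F p (- v) (\<lambda>x. - \<phi> (- x)) r"
  unfolding graph_at_def
proof (intro conjI allI impI)
  show "\<bar>- \<phi> (- x) - - \<phi> (- y)\<bar> \<le> \<bar>x - y\<bar>" for x y
  proof -
    have "\<bar>\<phi> (- y) - \<phi> (- x)\<bar> \<le> \<bar>(- y) - (- x)\<bar>" using assms unfolding graph_at_def by blast
    then show ?thesis by simp
  qed
  fix \<zeta> :: complex assume "norm \<zeta> < r"
  then have "p + v * (- \<zeta>) \<in> F \<longleftrightarrow> Im (- \<zeta>) = \<phi> (Re (- \<zeta>))"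
    using assms unfolding graph_at_def by (metis norm_minus_cancel)
  then show "p + - v * \<zeta> \<in> F \<longleftrightarrow> Im \<zeta> = - \<phi> (- Re \<zeta>)" by auto
qed (use assms in \<open>auto simp: graph_at_def\<close>)

lemma upper_box_sides:
  assumes "graph_fun \<phi> a" "norm \<zeta> < a" "Im \<zeta> \<noteq> \<phi> (Re \<zeta>)"
  shows "\<zeta> \<in> upper_box \<phi> a \<or> - \<zeta> \<in> upper_box (\<lambda>x. - \<phi> (- x)) a"
proof -
  have "\<bar>Re \<zeta>\<bar> < a" "\<bar>Im \<zeta>\<bar> < a"
    using assms(2) abs_Re_le_cmod[of \<zeta>] abs_Im_le_cmod[of \<zeta>] by auto
  then show ?thesis using assms(3) by (auto simp: upper_box_def)
qed

text \<open>Which side of the graph meets \<open>D\<close> is left open; the two sides are exchanged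
  by \<open>graph_at_reflect\<close>.\<close>

locale graph_domain = disc_cover f D for f D +
  assumes bddD: "bounded D" and neD: "D \<noteq> {}"
    and graph: "p \<in> frontier D \<Longrightarrow> \<exists>v \<phi> r. graph_at (frontier D) p v \<phi> r"
begin

lemma not_frontier: "w \<in> D \<Longrightarrow> w \<notin> frontier D"
  using openD by (simp add: frontier_def interior_open)

lemma bound_exists: obtains M where "M > 0" "\<And>w. w \<in> closure D \<Longrightarrow> norm w < M"
proof -
  obtain B where B: "\<And>w. w \<in> closure D \<Longrightarrow> norm w \<le> B"
    using bounded_closure[OF bddD] unfolding bounded_iff by blast
  show ?thesis by (rule that[of "\<bar>B\<bar> + 1"]) (use B in force)+
qed

lemma frontier_nonempty: "frontier D \<noteq> {}"
  using frontier_eq_empty[of D] neD bddD not_bounded_UNIV by blast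

text \<open>The box avoids the graph, and a connected set that meets \<open>D\<close> but not its
  frontier stays in \<open>D\<close>.\<close>

lemma upper_box_image_subset:
  assumes g: "graph_at (frontier D) p v \<phi> r"
    and z: "\<zeta> \<in> upper_box \<phi> (r/4)" "p + v * \<zeta> \<in> D"
  shows "(\<lambda>\<zeta>. p + v * \<zeta>) ` upper_box \<phi> (r/4) \<subseteq> D"
proof (rule ccontr)
  interpret graph_fun \<phi> "r/4" using g by (rule graph_at_graph_fun)
  let ?U = "(\<lambda>\<zeta>. p + v * \<zeta>) ` upper_box \<phi> (r/4)"
  assume "\<not> ?U \<subseteq> D"
  moreover have "connected ?U"
    by (intro connected_continuous_image continuous_intros starlike_imp_connected starlike_upper_box)
  moreover have "?U \<inter> D \<noteq> {}" using z by blast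
  ultimately have "?U \<inter> frontier D \<noteq> {}" by (intro connected_Int_frontier) auto
  then obtain \<xi> where x: "\<xi> \<in> upper_box \<phi> (r/4)" "p + v * \<xi> \<in> frontier D" by blast
  then have "Im \<xi> = \<phi> (Re \<xi>)" using g norm_upper_box[OF x(1)] by (simp add: graph_at_def)
  then show False using x by (simp add: upper_box_def)
qed

text \<open>The box is simply connected, so there is a lift \<open>s\<close> over it through a point
  of \<open>S\<close>; by uniqueness of lifts \<open>s\<close> recovers every point of
  \<open>S\<close> from its image.\<close>

lemma injective_over_upper_box:
  assumes g: "graph_at (frontier D) p v \<phi> r"
    and S: "connected S" "S \<subseteq> unit_disc" "(\<lambda>x. (f x - p) / v) ` S \<subseteq> upper_box \<phi> (r/4)"
  shows "inj_on f S"
proof (cases "S = {}")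
  case False
  then obtain x0 where x0: "x0 \<in> S" by blast
  interpret graph_fun \<phi> "r/4" using g by (rule graph_at_graph_fun)
  have v: "v \<noteq> 0" using g by (simp add: graph_at_def)
  let ?u = "\<lambda>\<zeta>. p + v * \<zeta>" and ?k = "\<lambda>x. (f x - p) / v"
  have k: "?k x \<in> upper_box \<phi> (r/4)" "?u (?k x) = f x" "x \<in> unit_disc" if "x \<in> S" for x
    using S that v by auto
  have sub: "?u ` upper_box \<phi> (r/4) \<subseteq> D"
    using upper_box_image_subset[OF g k(1)[OF x0]] maps k(2,3)[OF x0] by simp
  have hol: "?u holomorphic_on upper_box \<phi> (r/4)" by (intro holomorphic_intros)
  obtain s where s: "s holomorphic_on upper_box \<phi> (r/4)" "s ` upper_box \<phi> (r/4) \<subseteq> unit_disc"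
     "s (?k x0) = x0" "\<And>y. y \<in> upper_box \<phi> (r/4) \<Longrightarrow> f (s y) = ?u y"
    using lift[OF open_upper_box starlike_imp_simply_connected[OF starlike_upper_box] hol sub k(1)[OF x0]]
      k(2,3)[OF x0] by metis
  have contf: "continuous_on S f"
    using holomorphic_on_imp_continuous_on[OF holo] S(2) continuous_on_subset by blast
  have "s (?k x) = x" if "x \<in> S" for x
  proof (rule lift_unique[OF S(1) x0 that, of "\<lambda>x. s (?k x)" "\<lambda>x. x"])
    show "continuous_on S (\<lambda>x. s (?k x))"
      by (rule continuous_on_compose2[OF holomorphic_on_imp_continuous_on[OF s(1)] _ S(3)])
        (intro continuous_intros contf, use v in auto)
    show "f (s (?k x)) = f x" if "x \<in> S" for x using s(4) k that by metis
    show "(\<lambda>x. s (?k x)) ` S \<subseteq> unit_disc" using s(2) S(3) by blast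
  qed (use s S in auto)
  then show ?thesis by (metis inj_onI)
qed simp

text \<open>For \<open>p\<close> in \<open>D\<close> a small disc carries a section of
  \<open>f\<close>. For \<open>p\<close> on the frontier the image of a connected set near
  \<open>p\<close> cannot cross the graph, so it lies in one of the two boxes, where
  \<open>injective_over_upper_box\<close> applies.\<close>

lemma locally_injective_over_closure:
  assumes "p \<in> closure D"
  obtains N where "open N" "p \<in> N"
    "\<And>S. connected S \<Longrightarrow> S \<subseteq> unit_disc \<Longrightarrow> f ` S \<subseteq> N \<Longrightarrow> inj_on f S"
proof (cases "p \<in> D")
  case True
  then obtain d where d: "d > 0" "ball p d \<subseteq> D" using openD open_contains_ball by blast
  show thesis
  proof (rule that[of "ball p d"])
    fix S assume S: "connected S" "S \<subseteq> unit_disc" "f ` S \<subseteq> ball p d"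
    show "inj_on f S"
    proof (cases "S = {}")
      case False
      then obtain x0 where x0: "x0 \<in> S" by blast
      then have x: "x0 \<in> unit_disc" "f x0 \<in> ball p d" using S by auto
      have sc: "simply_connected (ball p d)" by (simp add: convex_imp_simply_connected)
      obtain s where s: "s holomorphic_on ball p d" "s ` ball p d \<subseteq> unit_disc" "s (f x0) = x0"
          "\<And>y. y \<in> ball p d \<Longrightarrow> f (s y) = y"
        using section_exists[OF open_ball sc d(2) x] by metis
      have contf: "continuous_on S f"
        using holomorphic_on_imp_continuous_on[OF holo] S(2) continuous_on_subset by blast
      have "s (f x) = x" if "x \<in> S" for x
      proof (rule lift_unique[OF S(1) x0 that, of "\<lambda>x. s (f x)" "\<lambda>x. x"])
        show "continuous_on S (\<lambda>x. s (f x))"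
          by (rule continuous_on_compose2[OF holomorphic_on_imp_continuous_on[OF s(1)] contf S(3)])
        show "f (s (f x)) = f x" if "x \<in> S" for x using s(4) S(3) that by blast
        show "(\<lambda>x. s (f x)) ` S \<subseteq> unit_disc" using s(2) S(3) by blast
      qed (use s S in auto)
      then show ?thesis by (metis inj_onI)
    qed simp
  qed (use d in auto)
next
  case False
  then have "p \<in> frontier D" using assms openD by (simp add: frontier_def interior_open)
  then obtain v \<phi> r where g: "graph_at (frontier D) p v \<phi> r" using graph by blast
  have v: "v \<noteq> 0" "r > 0" using g by (auto simp: graph_at_def)
  note g' = graph_at_reflect[OF g]
  let ?U = "upper_box \<phi> (r/4)" and ?V = "upper_box (\<lambda>x. - \<phi> (- x)) (r/4)"
  let ?N = "ball p (norm v * (r/4))"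
  show thesis
  proof (rule that[of ?N])
    show "p \<in> ?N" using v by simp
    fix S assume S: "connected S" "S \<subseteq> unit_disc" "f ` S \<subseteq> ?N"
    let ?k = "\<lambda>x. (f x - p) / v"
    have sides: "?k x \<in> ?U \<or> - ?k x \<in> ?V" if "x \<in> S" for x
    proof (rule upper_box_sides[OF graph_at_graph_fun[OF g]])
      have "dist p (f x) < norm v * (r/4)" using S(3) that by auto
      then show *: "norm (?k x) < r/4"
        using v by (simp add: norm_divide dist_norm norm_minus_commute field_simps)
      have "p + v * ?k x \<in> D" using v maps S(2) that by auto
      then show "Im (?k x) \<noteq> \<phi> (Re (?k x))"
        using not_frontier g less_trans[OF *, of r] v unfolding graph_at_def by auto
    qed
    have "continuous_on S ?k"
      using holomorphic_on_imp_continuous_on[OF holo] S(2) continuous_on_subset v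
      by (intro continuous_intros) auto
    then have conn: "connected (?k ` S)" using S(1) connected_continuous_image by blast
    have "?U \<inter> ?k ` S = {} \<or> uminus ` ?V \<inter> ?k ` S = {}"
    proof (rule connectedD[OF conn])
      show "open ?U" using graph_fun.open_upper_box[OF graph_at_graph_fun[OF g]] .
      show "open (uminus ` ?V)"
        using graph_fun.open_upper_box[OF graph_at_graph_fun[OF g']] open_negations by blast
      show "?U \<inter> uminus ` ?V \<inter> ?k ` S = {}" by (auto simp: upper_box_def)
      show "?k ` S \<subseteq> ?U \<union> uminus ` ?V"
        using sides by (force simp: image_iff)
    qed
    then consider "?U \<inter> ?k ` S = {}" | "uminus ` ?V \<inter> ?k ` S = {}" by blast
    then show "inj_on f S"
    proof cases
      case 1
      then have "(\<lambda>x. (f x - p) / - v) ` S \<subseteq> ?V" using sides by auto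
      then show ?thesis using injective_over_upper_box[OF g' S(1,2)] by simp
    next
      case 2
      have "- ?k x \<notin> ?V" if "x \<in> S" for x
        using 2 that by (metis (no_types, lifting) IntI add.inverse_inverse empty_iff imageI)
      then have "?k ` S \<subseteq> ?U" using sides by blast
      then show ?thesis using injective_over_upper_box[OF g S(1,2)] by simp
    qed
  qed simp
qed

text \<open>A deck transformation moving \<open>z\<close> too little gives a loop of small diameter in \<open>D\<close>;
  such a loop lies in a simply connected piece of \<open>D\<close>, so its lift closes up.\<close>
lemma deck_displacement:
  obtains c where "c > 0" "\<And>g z. g \<in> deck_group f \<Longrightarrow> z \<in> unit_disc \<Longrightarrow> g z \<noteq> z \<Longrightarrow>
    norm (g z - z) \<ge> c * (1 - norm z)"
proof -
  define \<G> where "\<G> = {N. open N \<and> (\<forall>S. connected S \<longrightarrow> S \<subseteq> unit_disc \<longrightarrow> f ` S \<subseteq> N \<longrightarrow> inj_on f S)}"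
  have cov: "closure D \<subseteq> \<Union>\<G>"
  proof
    fix p assume "p \<in> closure D"
    then show "p \<in> \<Union>\<G>"
    proof (rule locally_injective_over_closure)
      fix N assume "open N" "p \<in> N"
        "\<And>S. connected S \<Longrightarrow> S \<subseteq> unit_disc \<Longrightarrow> f ` S \<subseteq> N \<Longrightarrow> inj_on f S"
      then have "N \<in> \<G>" by (simp add: \<G>_def)
      then show "p \<in> \<Union>\<G>" using \<open>p \<in> N\<close> by (rule UnionI)
    qed
  qed
  have cpt: "compact (closure D)" using bddD by (simp add: compact_closure)
  have op: "open N" if "N \<in> \<G>" for N using that by (simp add: \<G>_def)
  \<comment> \<open>A Lebesgue number of the cover, serving all points of the compact closure at
    once.\<close>
  have "\<exists>\<epsilon>>0. \<forall>p\<in>closure D. \<exists>N\<in>\<G>. ball p \<epsilon> \<subseteq> N"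
    by (rule Heine_Borel_lemma[OF cpt cov op]) blast+
  then obtain \<epsilon> where e: "\<epsilon> > 0" "\<And>p. p \<in> closure D \<Longrightarrow> \<exists>N\<in>\<G>. ball p \<epsilon> \<subseteq> N"
    by blast
  obtain M where M: "M > 0" "\<And>w. w \<in> closure D \<Longrightarrow> norm w < M" using bound_exists by blast
  have fM: "norm (f z) < M" if "z \<in> unit_disc" for z
    using M(2) maps[OF that] closure_subset by blast
  \<comment> \<open>The bound 1/2 keeps the segment from \<open>z\<close> to \<open>g z\<close> in
    half of the ball of radius \<open>1 - norm z\<close>; the other bound keeps the image of the
    segment within \<epsilon> of \<open>f z\<close>.\<close>
  define c where "c = min (1/2) (\<epsilon> / (16 * M))"
  have c: "c > 0" "c \<le> 1/2" using e M by (auto simp: c_def)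
  have c': "8 * M * c < \<epsilon>"
  proof -
    have "8 * M * c \<le> 8 * M * (\<epsilon> / (16 * M))" using M by (intro mult_left_mono) (auto simp: c_def)
    also have "\<dots> < \<epsilon>" using M e by simp
    finally show ?thesis .
  qed
  show thesis
  proof (rule that[OF c(1)], rule ccontr)
    fix g z assume g: "g \<in> deck_group f" and z: "z \<in> unit_disc" and ne: "g z \<noteq> z"
      and "\<not> norm (g z - z) \<ge> c * (1 - norm z)"
    then have lt: "norm (g z - z) < c * (1 - norm z)" by simp
    define R where "R = 1 - norm z"
    have R: "R > 0" using z by (simp add: R_def)
    have ballR: "ball z R \<subseteq> unit_disc"
    proof
      fix x assume "x \<in> ball z R"
      then show "x \<in> unit_disc"
        using norm_triangle_sub[of x z] by (simp add: R_def dist_norm norm_minus_commute)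
    qed
    let ?S = "closed_segment z (g z)"
    have xS: "dist z x < c * R" if "x \<in> ?S" for x
      using segment_bound(1)[OF that] lt by (simp add: dist_norm norm_minus_commute R_def)
    have cR: "c * R \<le> R / 2" using mult_right_mono[OF c(2), of R] R by simp
    have SR: "?S \<subseteq> ball z R"
    proof
      fix x assume "x \<in> ?S"
      then have "dist z x < R" using xS[of x] cR R by linarith
      then show "x \<in> ball z R" by simp
    qed
    have "f ` ?S \<subseteq> ball (f z) \<epsilon>"
    proof (rule image_subsetI)
      fix x assume x: "x \<in> ?S"
      have d: "dist z x < c * R" using xS[OF x] .
      have "norm (f x - f z) * (R - dist z x) \<le> 4 * M * dist z x"
      proof (rule bounded_holomorphic_dist_bound[OF _ R])
        show "f holomorphic_on ball z R" using holo ballR holomorphic_on_subset by blast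
        show "x \<in> ball z R" using SR x by blast
      qed (use fM ballR in blast)
      also have "\<dots> \<le> 4 * M * (c * R)" using d M by (intro mult_left_mono) auto
      finally have 1: "norm (f x - f z) * (R - dist z x) \<le> 4 * M * (c * R)" .
      have "norm (f x - f z) * (R / 2) \<le> norm (f x - f z) * (R - dist z x)"
        using d cR by (intro mult_left_mono) auto
      with 1 have "norm (f x - f z) * R \<le> (8 * M * c) * R" by simp
      then have "norm (f x - f z) \<le> 8 * M * c" using R by simp
      then show "f x \<in> ball (f z) \<epsilon>" using c' by (simp add: dist_norm norm_minus_commute)
    qed
    moreover obtain N where "N \<in> \<G>" "ball (f z) \<epsilon> \<subseteq> N"
      using e(2)[of "f z"] maps[OF z] closure_subset by blast
    moreover have "connected ?S" "?S \<subseteq> unit_disc" using SR ballR by auto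
    ultimately have "inj_on f ?S" unfolding \<G>_def by blast
    moreover have "f (g z) = f z" using deck_inverse[OF g] z by blast
    ultimately have "g z = z" by (meson ends_in_segment inj_onD)
    then show False using ne by simp
  qed
qed

end

section \<open>Comparison of Poisson kernels near the frontier and over a compact set\<close>

context graph_domain
begin

text \<open>A compact disc in the box: the upward segments of length \<open>r/4\<close> from points
  with \<open>norm \<zeta> < r/16\<close> end here.\<close>

definition core :: "complex \<Rightarrow> complex \<Rightarrow> real \<Rightarrow> complex set" where
  "core p v r = (\<lambda>\<zeta>. p + v * \<zeta>) ` cball (Complex 0 (r/4)) (r/16)"

lemma compact_core: "compact (core p v r)"
  unfolding core_def by (intro compact_continuous_image continuous_intros compact_cball)

lemma core_subset:
  assumes g: "graph_at (frontier D) p v \<phi> r"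
  shows "core p v r \<subseteq> (\<lambda>\<zeta>. p + v * \<zeta>) ` upper_box \<phi> (r/4)"
  unfolding core_def
proof (rule image_mono, rule subsetI)
  interpret graph_fun \<phi> "r/4" using g by (rule graph_at_graph_fun)
  fix \<zeta> assume "\<zeta> \<in> cball (Complex 0 (r/4)) (r/16)"
  then have n: "norm (\<zeta> - Complex 0 (r/4)) \<le> r/16" by (simp add: dist_norm norm_minus_commute)
  have "\<bar>Re \<zeta>\<bar> \<le> r/16" using order_trans[OF abs_Re_le_cmod n] by simp
  moreover have "\<bar>Im \<zeta> - r/4\<bar> \<le> r/16" using order_trans[OF abs_Im_le_cmod n] by simp
  then have "Im \<zeta> \<le> r/4 + r/16" "Im \<zeta> \<ge> r/4 - r/16" by linarith+
  moreover have "\<phi> (Re \<zeta>) \<le> \<bar>Re \<zeta>\<bar>" by (rule le_abs)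
  ultimately show "\<zeta> \<in> upper_box \<phi> (r/4)" using a by (simp add: upper_box_def)
qed

text \<open>Lifting the upward segment from \<open>\<zeta>\<close> by a section of \<open>f\<close>, Harnack's inequality bounds the logarithmic
  derivative of the Poisson kernel along it by \<open>4 / \<tau>\<close>, where \<open>\<tau>\<close> is the height above the graph.\<close>
lemma poisson_decay_upper_box:
  assumes g: "graph_at (frontier D) p v \<phi> r"
    and z: "z \<in> unit_disc" "f z = p + v * \<zeta>" and \<zeta>: "\<zeta> \<in> upper_box \<phi> (r/4)" "norm \<zeta> < r/16"
    and \<omega>: "norm \<omega> = 1"
  obtains q z' where "q \<in> frontier D" "z' \<in> unit_disc" "f z' \<in> core p v r"
    "Re (cayley \<omega> z) * norm (f z - q) ^ 4 \<le> (norm v * (3/8 * r)) ^ 4 * Re (cayley \<omega> z')"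
proof -
  interpret graph_fun \<phi> "r/4" using g by (rule graph_at_graph_fun)
  let ?u = "\<lambda>\<zeta>. p + v * \<zeta>" and ?U = "upper_box \<phi> (r/4)"
  have r: "r > 0" using a by simp
  have v: "v \<noteq> 0" using g by (simp add: graph_at_def)
  have sub: "?u ` ?U \<subseteq> D"
    using upper_box_image_subset[OF g \<zeta>(1)] maps[OF z(1)] z(2) by simp
  have hol: "?u holomorphic_on ?U" by (intro holomorphic_intros)
  obtain s where s: "s holomorphic_on ?U" "s ` ?U \<subseteq> unit_disc" "s \<zeta> = z"
      "\<And>y. y \<in> ?U \<Longrightarrow> f (s y) = ?u y"
    using lift[OF open_upper_box starlike_imp_simply_connected[OF starlike_upper_box] hol sub \<zeta>(1) z]
    by metis
  define h where "h = (\<lambda>x. cayley \<omega> (s x))"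
  have holh: "h holomorphic_on ?U"
    using holomorphic_on_compose_gen[OF s(1) holomorphic_cayley[OF \<omega>] s(2)] by (simp add: h_def o_def)
  have hpos: "Re (h x) > 0" if "x \<in> ?U" for x
    unfolding h_def using s(2) that by (intro Re_cayley_pos \<omega>) auto
  define \<tau> where "\<tau> = Im \<zeta> - \<phi> (Re \<zeta>)"
  have b: "\<bar>Re \<zeta>\<bar> \<le> r/16" "\<bar>Im \<zeta>\<bar> \<le> r/16"
    using \<zeta>(2) abs_Re_le_cmod[of \<zeta>] abs_Im_le_cmod[of \<zeta>] by auto
  have \<tau>: "\<tau> > 0" "\<tau> \<le> r/8"
  proof -
    show "\<tau> > 0" using \<zeta>(1) by (simp add: \<tau>_def upper_box_def)
    show "\<tau> \<le> r/8" using b le_abs(2)[of "Re \<zeta>"] unfolding \<tau>_def by linarith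
  qed
  define c where "c = (\<lambda>t. \<zeta> + \<i> * of_real t)"
  \<comment> \<open>The fourth power of the height \<open>\<tau> + t\<close> above the graph
    compensates a relative decrease of the kernel at rate \<open>4 / (\<tau> + t)\<close>, so the
    product is nondecreasing.\<close>
  define G where "G = (\<lambda>t. Re (h (c t)) * (\<tau> + t) ^ 4)"
  have ball: "ball (c t) ((\<tau> + t) / 2) \<subseteq> ?U" if "0 \<le> t" "t \<le> r/4" for t
    using ball_subset_upper_box[of "c t"] that b by (simp add: c_def \<tau>_def algebra_simps)
  have inU: "c t \<in> ?U" if "0 \<le> t" "t \<le> r/4" for t
    using ball[OF that] \<tau> that centre_in_ball[of "c t" "(\<tau> + t)/2"] by auto
  have "G 0 \<le> G (r/4)"
  proof (rule DERIV_nonneg_imp_nondecreasing[of 0 "r/4" G])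
    fix t assume t: "0 \<le> t" "t \<le> r/4"
    let ?d = "deriv h (c t)"
    have "(h has_field_derivative ?d) (at (c t))"
      by (rule holomorphic_derivI[OF holh open_upper_box inU[OF t]])
    moreover have "(c has_vector_derivative \<i>) (at t)"
      unfolding c_def by (auto intro!: derivative_eq_intros simp: has_vector_derivative_def scaleR_conv_of_real)
    ultimately have "((h \<circ> c) has_vector_derivative (\<i> * ?d)) (at t)"
      by (intro field_vector_diff_chain_at)
    then have "((\<lambda>t. Re ((h \<circ> c) t)) has_vector_derivative Re (\<i> * ?d)) (at t)"
      by (rule bounded_linear.has_vector_derivative[OF bounded_linear_Re])
    then have d1: "((\<lambda>t. Re (h (c t))) has_real_derivative Re (\<i> * ?d)) (at t)"
      by (simp add: has_real_derivative_iff_has_vector_derivative)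
    have d2: "((\<lambda>t. (\<tau> + t) ^ 4) has_real_derivative 4 * (\<tau> + t) ^ 3) (at t)"
      by (auto intro!: derivative_eq_intros)
    have der: "(G has_real_derivative
        (Re (\<i> * ?d) * (\<tau> + t) ^ 4 + (4 * (\<tau> + t) ^ 3) * Re (h (c t)))) (at t)"
      unfolding G_def by (rule DERIV_mult[OF d1 d2])
    have "norm ?d * ((\<tau> + t) / 2) \<le> 2 * Re (h (c t))"
      using ball[OF t] \<tau> t
      by (intro half_plane_schwarz_deriv holomorphic_on_subset[OF holh] hpos) auto
    then have "norm ?d * (\<tau> + t) \<le> 4 * Re (h (c t))" by simp
    moreover have "- Re (\<i> * ?d) * (\<tau> + t) \<le> norm ?d * (\<tau> + t)"
      using \<tau> t abs_Im_le_cmod[of ?d] by (intro mult_right_mono) auto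
    ultimately have "0 \<le> Re (\<i> * ?d) * (\<tau> + t) + 4 * Re (h (c t))" by simp
    then have "0 \<le> (\<tau> + t) ^ 3 * (Re (\<i> * ?d) * (\<tau> + t) + 4 * Re (h (c t)))"
      using \<tau> t by simp
    also have "\<dots> = Re (\<i> * ?d) * (\<tau> + t) ^ 4 + (4 * (\<tau> + t) ^ 3) * Re (h (c t))"
      by (simp add: power_Suc numeral_eq_Suc algebra_simps)
    finally show "\<exists>y. (G has_real_derivative y) (at t) \<and> 0 \<le> y" using der by blast
  qed (use r in simp)
  \<comment> \<open>As \<tau> is at most \<open>r/8\<close>, the final height is at most
    \<open>3/8 * r\<close>.\<close>
  also have "G (r/4) \<le> Re (h (c (r/4))) * (3/8 * r) ^ 4"
    unfolding G_def using \<tau> r hpos[OF inU[of "r/4"]] by (intro mult_left_mono power_mono) auto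
  finally have main: "Re (cayley \<omega> z) * \<tau> ^ 4 \<le> Re (h (c (r/4))) * (3/8 * r) ^ 4"
    by (simp add: G_def c_def h_def s)
  \<comment> \<open>The frontier point below \<zeta> in these coordinates, at distance
    \<open>norm v * \<tau>\<close> from \<open>f z\<close>.\<close>
  define q where "q = p + v * Complex (Re \<zeta>) (\<phi> (Re \<zeta>))"
  show thesis
  proof
    have "norm (Complex (Re \<zeta>) (\<phi> (Re \<zeta>))) \<le> \<bar>Re \<zeta>\<bar> + \<bar>\<phi> (Re \<zeta>)\<bar>" using cmod_le[of "Complex (Re \<zeta>) (\<phi> (Re \<zeta>))"] by simp
    also have "\<dots> < r" using b r le_abs[of "Re \<zeta>"] by linarith
    finally show "q \<in> frontier D" using g by (simp add: graph_at_def q_def)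
    have "\<zeta> - Complex (Re \<zeta>) (\<phi> (Re \<zeta>)) = \<i> * of_real \<tau>" by (simp add: complex_eq_iff \<tau>_def)
    moreover have "f z - q = v * (\<zeta> - Complex (Re \<zeta>) (\<phi> (Re \<zeta>)))"
      by (simp add: z(2) q_def right_diff_distrib)
    ultimately have "f z - q = v * (\<i> * of_real \<tau>)" by simp
    then have nq: "norm (f z - q) = norm v * \<tau>" using \<tau> by (simp add: norm_mult)
    show "s (c (r/4)) \<in> unit_disc" using s(2) inU[of "r/4"] r by auto
    have "c (r/4) \<in> cball (Complex 0 (r/4)) (r/16)"
    proof -
      have "c (r/4) - Complex 0 (r/4) = \<zeta>" by (simp add: c_def complex_eq_iff)
      then show ?thesis using \<zeta>(2) by (simp add: dist_norm norm_minus_commute)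
    qed
    then show "f (s (c (r/4))) \<in> core p v r"
      using s(4)[OF inU[of "r/4"]] r unfolding core_def by (intro image_eqI) auto
    have "Re (cayley \<omega> z) * norm (f z - q) ^ 4 = norm v ^ 4 * (Re (cayley \<omega> z) * \<tau> ^ 4)"
      by (simp add: nq power_mult_distrib)
    also have "\<dots> \<le> norm v ^ 4 * (Re (h (c (r/4))) * (3/8 * r) ^ 4)"
      using main by (intro mult_left_mono) auto
    also have "\<dots> = (norm v * (3/8 * r)) ^ 4 * Re (cayley \<omega> (s (c (r/4))))"
      unfolding h_def power_mult_distrib[of "norm v"] by (simp only: mult_ac)
    finally show "Re (cayley \<omega> z) * norm (f z - q) ^ 4 \<le> (norm v * (3/8 * r)) ^ 4 * Re (cayley \<omega> (s (c (r/4))))" .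
  qed
qed

text \<open>If \<open>\<omega>\<close> is not in the limit set, points \<open>z'\<close> over \<open>K\<close> stay away from \<open>\<omega>\<close>, so the kernel at \<open>z'\<close> is bounded
  and \<open>norm (f z - q)\<close> is at most a power of \<open>1 - norm z\<close> for \<open>z\<close> on the radius ending at \<open>\<omega>\<close>.\<close>
definition poisson_decay :: "complex set \<Rightarrow> real \<Rightarrow> complex \<Rightarrow> bool" where
  "poisson_decay K M z \<longleftrightarrow> (\<forall>\<omega>. norm \<omega> = 1 \<longrightarrow> (\<exists>q\<in>frontier D. \<exists>z'\<in>unit_disc. f z' \<in> K \<and>
     Re (cayley \<omega> z) * norm (f z - q) ^ 4 \<le> M * Re (cayley \<omega> z')))"

lemma poisson_decay_mono:
  assumes "poisson_decay K M z" "K \<subseteq> K'" "M \<le> M'"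
  shows "poisson_decay K' M' z"
  unfolding poisson_decay_def
proof (intro allI impI)
  fix \<omega> :: complex assume \<omega>: "norm \<omega> = 1"
  then obtain q z' where q: "q \<in> frontier D" "z' \<in> unit_disc" "f z' \<in> K"
     "Re (cayley \<omega> z) * norm (f z - q) ^ 4 \<le> M * Re (cayley \<omega> z')"
    using assms(1) unfolding poisson_decay_def by blast
  have "M * Re (cayley \<omega> z') \<le> M' * Re (cayley \<omega> z')"
    using Re_cayley_pos[OF \<omega>, of z'] q(2) assms(3) by (intro mult_right_mono) auto
  then have "Re (cayley \<omega> z) * norm (f z - q) ^ 4 \<le> M' * Re (cayley \<omega> z')" using q(4) by linarith
  then show "\<exists>q\<in>frontier D. \<exists>z'\<in>unit_disc. f z' \<in> K' \<and>
     Re (cayley \<omega> z) * norm (f z - q) ^ 4 \<le> M' * Re (cayley \<omega> z')"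
    using q assms(2) by blast
qed

text \<open>A point of \<open>D\<close> near \<open>p\<close> lies on one of the two sides of the
  graph, and that side then belongs to \<open>D\<close>; \<open>K\<close> collects the cores of the
  sides.\<close>

lemma poisson_decay_local:
  assumes "p \<in> frontier D"
  shows "\<exists>N K M. open N \<and> p \<in> N \<and> compact K \<and> K \<subseteq> D \<and> M \<ge> 0 \<and>
    (\<forall>z\<in>unit_disc. f z \<in> N \<longrightarrow> poisson_decay K M z)"
proof -
  obtain v \<phi> r where g: "graph_at (frontier D) p v \<phi> r" using graph[OF assms] by blast
  have v: "v \<noteq> 0" "r > 0" using g by (auto simp: graph_at_def)
  note g' = graph_at_reflect[OF g]
  let ?M = "(norm v * (3/8 * r)) ^ 4"
  let ?N = "ball p (norm v * (r/16))"
  \<comment> \<open>A side of the graph may lie outside \<open>D\<close>; a core that is not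
    contained in \<open>D\<close> is replaced by the empty set.\<close>
  define C where "C = (\<lambda>v. if core p v r \<subseteq> D then core p v r else {})"
  have C: "compact (C w)" "C w \<subseteq> D" for w by (auto simp: C_def compact_core)
  have one_side: "poisson_decay (C v') ?M z"
    if g: "graph_at (frontier D) p v' \<psi> r" and nv: "norm v' = norm v" and z: "z \<in> unit_disc"
      "f z = p + v' * \<zeta>" and \<zeta>: "norm \<zeta> < r/16" "\<zeta> \<in> upper_box \<psi> (r/4)" for \<zeta> v' \<psi> z
    unfolding poisson_decay_def
  proof (intro allI impI)
    fix \<omega> :: complex assume \<omega>: "norm \<omega> = 1"
    have "core p v' r \<subseteq> D"
      using core_subset[OF g] upper_box_image_subset[OF g \<zeta>(2)] maps[OF z(1)] z(2) by auto
    then have "C v' = core p v' r" by (simp add: C_def)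
    then show "\<exists>q\<in>frontier D. \<exists>z'\<in>unit_disc. f z' \<in> C v' \<and>
       Re (cayley \<omega> z) * norm (f z - q) ^ 4 \<le> ?M * Re (cayley \<omega> z')"
      using poisson_decay_upper_box[OF g z \<zeta>(2,1) \<omega>] nv by metis
  qed
  have "poisson_decay (C v \<union> C (- v)) ?M z" if z: "z \<in> unit_disc" "f z \<in> ?N" for z
  proof -
    define \<zeta> where "\<zeta> = (f z - p) / v"
    have fz: "f z = p + v * \<zeta>" using v by (simp add: \<zeta>_def)
    have n: "norm \<zeta> < r/16"
      using z(2) v by (simp add: \<zeta>_def norm_divide dist_norm norm_minus_commute field_simps)
    then have n4: "norm \<zeta> < r/4" "norm \<zeta> < r" using v by auto
    have "Im \<zeta> \<noteq> \<phi> (Re \<zeta>)"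
      using not_frontier[OF maps[OF z(1)]] g n4 fz unfolding graph_at_def by auto
    then consider "\<zeta> \<in> upper_box \<phi> (r/4)" | "- \<zeta> \<in> upper_box (\<lambda>x. - \<phi> (- x)) (r/4)"
      using upper_box_sides[OF graph_at_graph_fun[OF g] n4(1)] by blast
    then show ?thesis
    proof cases
      case 1
      then have "poisson_decay (C v) ?M z" using one_side[OF g _ z(1) fz n] by simp
      then show ?thesis by (rule poisson_decay_mono) auto
    next
      case 2
      then have "poisson_decay (C (- v)) ?M z"
        using one_side[OF g' _ z(1), of "- \<zeta>"] fz n by simp
      then show ?thesis by (rule poisson_decay_mono) auto
    qed
  qed
  then show ?thesis
    using C v by (intro exI[of _ ?N] exI[of _ "C v \<union> C (- v)"] exI[of _ ?M]) (auto intro: compact_Un)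
qed

text \<open>Finitely many of the local neighbourhoods cover the compact frontier. The rest of
  \<open>closure D\<close> is a compact subset of \<open>D\<close>, over which \<open>z' = z\<close>
  serves.\<close>

lemma poisson_decay_global:
  obtains K M where "compact K" "K \<subseteq> D" "M > 0" "\<And>z. z \<in> unit_disc \<Longrightarrow> poisson_decay K M z"
proof -
  define P where "P = (\<lambda>p N K M. open N \<and> p \<in> N \<and> compact K \<and> K \<subseteq> D \<and> M \<ge> (0::real) \<and>
    (\<forall>z\<in>unit_disc. f z \<in> N \<longrightarrow> poisson_decay K M z))"
  have "\<forall>p\<in>frontier D. \<exists>N. \<exists>K M. P p N K M" using poisson_decay_local by (simp add: P_def)
  then obtain N where "\<forall>p\<in>frontier D. \<exists>K M. P p (N p) K M"
    using bchoice[of "frontier D" "\<lambda>p N. \<exists>K M. P p N K M"] by blast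
  then obtain K where "\<forall>p\<in>frontier D. \<exists>M. P p (N p) (K p) M"
    using bchoice[of "frontier D" "\<lambda>p K. \<exists>M. P p (N p) K M"] by blast
  then obtain M where "\<forall>p\<in>frontier D. P p (N p) (K p) (M p)"
    using bchoice[of "frontier D" "\<lambda>p M. P p (N p) (K p) M"] by blast
  then have N: "\<And>p. p \<in> frontier D \<Longrightarrow> open (N p)" "\<And>p. p \<in> frontier D \<Longrightarrow> p \<in> N p"
    and K: "\<And>p. p \<in> frontier D \<Longrightarrow> compact (K p)" "\<And>p. p \<in> frontier D \<Longrightarrow> K p \<subseteq> D"
    and M: "\<And>p. p \<in> frontier D \<Longrightarrow> M p \<ge> (0::real)"
    and dec: "\<And>p z. p \<in> frontier D \<Longrightarrow> z \<in> unit_disc \<Longrightarrow> f z \<in> N p \<Longrightarrow> poisson_decay (K p) (M p) z"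
    by (auto simp: P_def)
  have "compact (frontier D)" using bddD by (simp add: compact_frontier_bounded)
  then obtain T where T: "T \<subseteq> frontier D" "finite T" "frontier D \<subseteq> (\<Union>p\<in>T. N p)"
    using compactE_image[of "frontier D" "frontier D" N] N by (metis UN_I subsetI)
  let ?V = "\<Union>p\<in>T. N p"
  have opV: "open ?V" using T N by blast
  define K0 where "K0 = closure D - ?V"
  have "compact K0" unfolding K0_def using bddD opV by (simp add: compact_diff compact_closure)
  have K0D: "K0 \<subseteq> D" using T(3) openD by (auto simp: K0_def frontier_def interior_open)
  obtain B where B: "B > 0" "\<And>w. w \<in> closure D \<Longrightarrow> norm w < B" using bound_exists by blast
  define K' where "K' = K0 \<union> (\<Union>p\<in>T. K p)"
  \<comment> \<open>The sum dominates each of the finitely many local constants;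
    \<open>(2 * B) ^ 4\<close> bounds the fourth power of the distance between \<open>f z\<close>
    and a frontier point.\<close>
  define M' where "M' = (\<Sum>p\<in>T. M p) + (2 * B) ^ 4"
  have M': "M' > 0" unfolding M'_def using B M T by (intro add_nonneg_pos sum_nonneg) auto
  show thesis
  proof (rule that[of K' M'])
    show "compact K'" unfolding K'_def using T K by (intro compact_Un \<open>compact K0\<close> compact_UN) auto
    show "K' \<subseteq> D" unfolding K'_def using K0D K T by blast
    fix z assume z: "z \<in> unit_disc"
    show "poisson_decay K' M' z"
    proof (cases "f z \<in> ?V")
      case True
      then obtain p where p: "p \<in> T" "f z \<in> N p" by blast
      have "M p \<le> M'"
        unfolding M'_def using T M p B by (intro add_increasing2 member_le_sum) auto
      moreover have "K p \<subseteq> K'" unfolding K'_def using p by blast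
      ultimately show ?thesis using dec[of p z] p T z poisson_decay_mono by blast
    next
      case False
      have fz: "f z \<in> closure D" using maps[OF z] closure_subset by blast
      then have "f z \<in> K'" using False by (simp add: K'_def K0_def)
      moreover obtain q where q: "q \<in> frontier D" using frontier_nonempty by blast
      moreover have "Re (cayley \<omega> z) * norm (f z - q) ^ 4 \<le> M' * Re (cayley \<omega> z)" if "norm \<omega> = 1" for \<omega>
      proof -
        have "norm (f z - q) \<le> norm (f z) + norm q" by (rule norm_triangle_ineq4)
        also have "\<dots> \<le> 2 * B"
          using B(2)[OF fz] B(2)[of q] q by (simp add: frontier_def)
        finally have "norm (f z - q) ^ 4 \<le> (2 * B) ^ 4" by (intro power_mono) auto
        also have "\<dots> \<le> M'" unfolding M'_def using M T by (simp add: sum_nonneg subset_iff)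
        finally show ?thesis
          using Re_cayley_pos[OF that, of z] z by (simp add: mult.commute)
      qed
      ultimately show ?thesis using z unfolding poisson_decay_def by blast
    qed
  qed (rule M')
qed

section \<open>Upper and lower bounds for the derivative of the covering\<close>

lemma ball_subset_unit_disc:
  fixes z :: complex
  shows "ball z (1 - norm z) \<subseteq> unit_disc"
proof
  fix x assume "x \<in> ball z (1 - norm z)"
  then show "x \<in> unit_disc"
    using norm_triangle_sub[of x z] by (simp add: dist_norm norm_minus_commute)
qed

lemma deriv_bound:
  obtains M where "M > 0" "\<And>z. z \<in> unit_disc \<Longrightarrow> norm (deriv f z) * (1 - norm z) \<le> M"
proof -
  obtain M where M: "M > 0" "\<And>w. w \<in> closure D \<Longrightarrow> norm w < M" using bound_exists by blast
  have "norm (deriv f z) * (1 - norm z) \<le> 4 * M" if "z \<in> unit_disc" for z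
  proof (rule bounded_holomorphic_deriv_bound)
    show "f holomorphic_on ball z (1 - norm z)"
      using holo ball_subset_unit_disc holomorphic_on_subset by blast
    show "norm (f x) < M" if "x \<in> ball z (1 - norm z)" for x
      using that ball_subset_unit_disc[of z] M(2) maps closure_subset by blast
  qed (use that in simp)
  then show ?thesis using that[of "4 * M"] M by simp
qed

text \<open>The Schwarz lemma is applied to a square root of \<open>f - q\<close>.\<close>
lemma deriv_bound_frontier:
  obtains B where "B > 0" "\<And>z q. z \<in> unit_disc \<Longrightarrow> q \<in> frontier D \<Longrightarrow>
    norm (deriv f z) * (1 - norm z) \<le> B * sqrt (norm (f z - q))"
proof -
  obtain M where M: "M > 0" "\<And>w. w \<in> closure D \<Longrightarrow> norm w < M" using bound_exists by blast
  define B where "B = sqrt (2 * M)"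
  have B: "B > 0" using M by (simp add: B_def)
  have "norm (deriv f z) * (1 - norm z) \<le> 8 * B * sqrt (norm (f z - q))"
    if z: "z \<in> unit_disc" and q: "q \<in> frontier D" for z q
  proof -
    have "(\<lambda>x. f x - q) holomorphic_on unit_disc" by (intro holomorphic_intros holo)
    moreover have "f x - q \<noteq> 0" if "x \<in> unit_disc" for x
      using maps[OF that] not_frontier q by auto
    ultimately obtain u where u: "u holomorphic_on unit_disc" "\<And>x. x \<in> unit_disc \<Longrightarrow> f x - q = (u x)\<^sup>2"
      using contractible_imp_holomorphic_sqrt[of "\<lambda>x. f x - q" unit_disc] convex_imp_contractible[of unit_disc]
      by auto
    have nu: "norm (u x) = sqrt (norm (f x - q))" if "x \<in> unit_disc" for x
      using u(2)[OF that] by (simp add: norm_power)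
    have uB: "norm (u x) < B" if "x \<in> unit_disc" for x
    proof -
      have "norm (f x - q) \<le> norm (f x) + norm q" by (rule norm_triangle_ineq4)
      also have "\<dots> < 2 * M"
        using M(2)[of "f x"] M(2)[of q] q maps[OF that] closure_subset by (fastforce simp: frontier_def)
      finally show ?thesis using nu[OF that] by (simp add: B_def)
    qed
    have du: "norm (deriv u z) * (1 - norm z) \<le> 4 * B"
    proof (rule bounded_holomorphic_deriv_bound)
      show "u holomorphic_on ball z (1 - norm z)"
        using u(1) ball_subset_unit_disc holomorphic_on_subset by blast
      show "norm (u x) < B" if "x \<in> ball z (1 - norm z)" for x
        using uB that ball_subset_unit_disc[of z] by blast
    qed (use z in simp)
    have "(u has_field_derivative deriv u z) (at z)" by (rule holomorphic_derivI[OF u(1) open_ball z])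
    \<comment> \<open>Differentiating \<open>u * u + q\<close> brings out the factor
      \<open>norm (u z)\<close>, which is the square root of \<open>norm (f z - q)\<close>.\<close>
    then have "((\<lambda>x. (u x)\<^sup>2 + q) has_field_derivative 2 * u z * deriv u z) (at z)"
      by (auto intro!: derivative_eq_intros)
    then have "(f has_field_derivative 2 * u z * deriv u z) (at z)"
      by (rule has_field_derivative_transform_within_open[OF _ open_ball z]) (use u(2) in \<open>metis diff_add_cancel\<close>)
    then have "deriv f z = 2 * u z * deriv u z" by (rule DERIV_imp_deriv)
    then have "norm (deriv f z) * (1 - norm z) = 2 * norm (u z) * (norm (deriv u z) * (1 - norm z))"
      by (simp add: norm_mult)
    also have "\<dots> \<le> 2 * norm (u z) * (4 * B)" using du by (intro mult_left_mono) auto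
    finally show ?thesis using nu[OF z] by (simp add: mult_ac)
  qed
  then show ?thesis using that[of "8 * B"] B by simp
qed

text \<open>Around \<open>f z\<close> there is a section \<open>s\<close> on a disc whose radius
  \<open>e\<close> does not depend on \<open>z\<close>. The Schwarz estimate for
  \<open>1 - cnj \<omega> * s\<close> bounds its derivative by \<open>2 * (1 - t) / e\<close>, and
  this derivative is the reciprocal of that of \<open>f\<close>.\<close>

lemma deriv_lower_bound:
  assumes "compact K" "K \<subseteq> D"
  obtains d where "d > 0" "\<And>t \<omega>. 0 \<le> t \<Longrightarrow> t < 1 \<Longrightarrow> norm \<omega> = 1 \<Longrightarrow> f (of_real t * \<omega>) \<in> K \<Longrightarrow>
    norm (deriv f (of_real t * \<omega>)) * (1 - t) \<ge> d"
proof -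
  obtain e where e: "e > 0" "(\<Union>w\<in>K. ball w e) \<subseteq> D"
    using compact_subset_open_imp_ball_epsilon_subset[OF assms(1) openD assms(2)] by blast
  have "norm (deriv f (of_real t * \<omega>)) * (1 - t) \<ge> e / 2"
    if t: "0 \<le> t" "t < 1" and \<omega>: "norm \<omega> = 1" and K: "f (of_real t * \<omega>) \<in> K" for t \<omega>
  proof -
    define z where "z = of_real t * \<omega>"
    have nz: "norm z = t" using t \<omega> by (simp add: z_def norm_mult)
    have z: "z \<in> unit_disc" using nz t by simp
    let ?B = "ball (f z) e"
    have sub: "?B \<subseteq> D" using e K unfolding z_def by blast
    have sc: "simply_connected ?B" by (simp add: convex_imp_simply_connected)
    have cin: "f z \<in> ?B" using e by simp
    obtain s where s: "s holomorphic_on ?B" "s ` ?B \<subseteq> unit_disc" "s (f z) = z" "\<And>y. y \<in> ?B \<Longrightarrow> f (s y) = y"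
      using section_exists[OF open_ball sc sub z cin] by metis
    have ds: "(s has_field_derivative deriv s (f z)) (at (f z))"
      by (rule holomorphic_derivI[OF s(1) open_ball cin])
    have df: "(f has_field_derivative deriv f z) (at z)"
      by (rule holomorphic_derivI[OF holo open_ball z])
    have "((\<lambda>y. f (s y)) has_field_derivative deriv f z * deriv s (f z)) (at (f z))"
      using DERIV_chain2[of f "deriv f z" s "f z"] df ds s(3) by simp
    then have "((\<lambda>y. y) has_field_derivative deriv f z * deriv s (f z)) (at (f z))"
      by (rule has_field_derivative_transform_within_open[OF _ open_ball cin]) (rule s(4))
    then have one: "deriv f z * deriv s (f z) = 1"
      using DERIV_unique DERIV_ident by blast
    let ?h = "\<lambda>y. 1 - cnj \<omega> * s y"
    have "norm (deriv ?h (f z)) * e \<le> 2 * Re (?h (f z))"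
    proof (rule half_plane_schwarz_deriv)
      show "?h holomorphic_on ?B" by (intro holomorphic_intros s)
      show "Re (?h x) > 0" if "x \<in> ?B" for x
      proof -
        have "s x \<in> unit_disc" using s(2) that by blast
        then have "norm (cnj \<omega> * s x) < 1" using \<omega> by (simp add: norm_mult)
        then have "Re (cnj \<omega> * s x) < 1" using complex_Re_le_cmod[of "cnj \<omega> * s x"] by linarith
        then show ?thesis by simp
      qed
    qed fact
    moreover have "(?h has_field_derivative (0 - cnj \<omega> * deriv s (f z))) (at (f z))"
      by (intro DERIV_diff DERIV_const DERIV_cmult ds)
    then have "deriv ?h (f z) = - (cnj \<omega> * deriv s (f z))" by (simp add: DERIV_imp_deriv)
    moreover have "Re (?h (f z)) = 1 - t"
    proof -
      have "cnj \<omega> * \<omega> = 1" using \<omega> by (metis complex_norm_square mult.commute of_real_1 one_power2)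
      then have "cnj \<omega> * z = of_real t" by (simp add: z_def mult.left_commute)
      then show ?thesis using s(3) by simp
    qed
    ultimately have le: "norm (deriv s (f z)) * e \<le> 2 * (1 - t)" using \<omega> by (simp add: norm_mult)
    have "norm (deriv f z) * norm (deriv s (f z)) = 1" using one by (metis norm_mult norm_one)
    then have "e = norm (deriv f z) * (norm (deriv s (f z)) * e)" by (simp flip: mult.assoc)
    also have "\<dots> \<le> norm (deriv f z) * (2 * (1 - t))" using le by (intro mult_left_mono) auto
    finally show ?thesis by (simp add: z_def algebra_simps)
  qed
  then show ?thesis using that[of "e / 2"] e by simp
qed

end

section \<open>Conformal automorphisms of the disc\<close>

text \<open>Composition with a Moebius map taking 0 to \<open>h 0\<close> gives an automorphism
  \<open>T\<close> fixing 0. The Schwarz lemma for \<open>T\<close> and for its inverse forces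
  equality, so \<open>T\<close> is a rotation.\<close>

lemma disc_automorphism_moebius:
  assumes g: "g holomorphic_on unit_disc" "\<And>z. z \<in> unit_disc \<Longrightarrow> g z \<in> unit_disc"
    and h: "h holomorphic_on unit_disc" "\<And>z. z \<in> unit_disc \<Longrightarrow> h z \<in> unit_disc"
    and hg: "\<And>z. z \<in> unit_disc \<Longrightarrow> h (g z) = z" and gh: "\<And>z. z \<in> unit_disc \<Longrightarrow> g (h z) = z"
  obtains c b where "norm c = 1" "norm b < 1" "\<And>z. z \<in> unit_disc \<Longrightarrow> g z = c * (z - b) / (1 - cnj b * z)"
proof -
  define b where "b = h 0"
  have b: "norm b < 1" "g b = 0" using h(2)[of 0] gh[of 0] by (auto simp: b_def)
  let ?m = "Moebius_function 0 b" and ?n = "Moebius_function 0 (- b)"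
  have m: "?m holomorphic_on unit_disc" "?n holomorphic_on unit_disc"
    using Moebius_function_holomorphic b(1) by auto
  have mb: "norm (?m z) < 1" "norm (?n z) < 1" if "norm z < 1" for z
    using Moebius_function_norm_lt_1[of b z 0] Moebius_function_norm_lt_1[of "- b" z 0] b(1) that by auto
  have mn: "?m (?n z) = z" "?n (?m z) = z" if "norm z < 1" for z
    using Moebius_function_compose[of b "- b" z] Moebius_function_compose[of "- b" b z] b(1) that by auto
  define T where "T = (\<lambda>z. g (?n z))"
  define T' where "T' = (\<lambda>z. ?m (h z))"
  have hol: "T holomorphic_on unit_disc" "T' holomorphic_on unit_disc"
    using holomorphic_on_compose_gen[OF m(2) g(1)] holomorphic_on_compose_gen[OF h(1) m(1)] mb h(2)
    by (auto simp: T_def T'_def o_def image_subset_iff)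
  have T0: "T 0 = 0" "T' 0 = 0"
    using b by (auto simp: T_def T'_def Moebius_function_def b_def[symmetric])
  have T1: "norm (T z) < 1" "norm (T' z) < 1" if "norm z < 1" for z
    using mb that g(2) h(2) by (auto simp: T_def T'_def)
  have TT: "T' (T z) = z" if "norm z < 1" for z
    using hg[of "?n z"] mb mn that by (simp add: T_def T'_def)
  \<comment> \<open>The point 1/2 is an arbitrary nonzero test point: equality at one such point
    makes \<open>T\<close> a rotation.\<close>
  have "norm (T (1/2)) = norm (1/2 :: complex)"
  proof (rule antisym)
    show "norm (T (1/2)) \<le> norm (1/2 :: complex)"
      by (rule Schwarz_Lemma(1)[OF hol(1) T0(1) T1(1)]) auto
    have "norm (T' (T (1/2))) \<le> norm (T (1/2))"
      by (rule Schwarz_Lemma(1)[OF hol(2) T0(2) T1(2)]) (auto intro: T1)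
    then show "norm (1/2 :: complex) \<le> norm (T (1/2))" using TT[of "1/2"] by simp
  qed
  then have "\<exists>z. norm z < 1 \<and> z \<noteq> 0 \<and> norm (T z) = norm z" by (intro exI[of _ "1/2"]) auto
  then obtain \<alpha> where \<alpha>: "\<And>z. norm z < 1 \<Longrightarrow> T z = \<alpha> * z" "norm \<alpha> = 1"
    using Schwarz_Lemma(3)[OF hol(1) T0(1) T1(1), of 0] by auto
  show thesis
  proof (rule that[OF \<alpha>(2) b(1)])
    fix z assume "z \<in> unit_disc"
    then have z: "norm z < 1" by simp
    have "g z = T (?m z)" using mn(2)[OF z] by (simp add: T_def)
    also have "\<dots> = \<alpha> * ?m z" using \<alpha>(1) mb(1)[OF z] by blast
    finally show "g z = \<alpha> * (z - b) / (1 - cnj b * z)" by (simp add: Moebius_function_simple)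
  qed
qed

locale moebius =
  fixes c b :: complex
  assumes c: "norm c = 1" and b: "norm b < 1"
begin

definition mo :: "complex \<Rightarrow> complex" where "mo z = c * (z - b) / (1 - cnj b * z)"

text \<open>The reciprocal of the modulus of the derivative of \<open>mo\<close> at \<zeta>. At a
  fixed point on the circle it is the linear coefficient in \<open>cayley_mo\<close>.\<close>

definition mult :: "complex \<Rightarrow> real" where "mult \<zeta> = (norm (1 - cnj b * \<zeta>))\<^sup>2 / (1 - (norm b)\<^sup>2)"

lemma denom_nonzero: "norm z \<le> 1 \<Longrightarrow> 1 - cnj b * z \<noteq> 0"
proof
  assume "norm z \<le> 1" "1 - cnj b * z = 0"
  then have "1 = norm b * norm z" by (metis complex_mod_cnj eq_iff_diff_eq_0 norm_mult norm_one)
  also have "\<dots> \<le> norm b" using \<open>norm z \<le> 1\<close> by (simp add: mult_left_le)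
  finally show False using b by simp
qed

lemma norm_b_pos: "1 - (norm b)\<^sup>2 > 0"
  using b by (simp add: abs_square_less_1)

lemma mult_pos: "norm \<zeta> \<le> 1 \<Longrightarrow> mult \<zeta> > 0"
  unfolding mult_def using denom_nonzero norm_b_pos by simp

lemma fixed_iff:
  assumes "norm z \<le> 1"
  shows "mo z = z \<longleftrightarrow> cnj b * z\<^sup>2 + (c - 1) * z - c * b = 0"
proof -
  have "mo z = z \<longleftrightarrow> c * (z - b) = z * (1 - cnj b * z)"
    using denom_nonzero[OF assms] by (simp add: mo_def divide_eq_eq)
  also have "\<dots> \<longleftrightarrow> cnj b * z\<^sup>2 + (c - 1) * z - c * b = 0"
    by (auto simp: power2_eq_square algebra_simps)
  finally show ?thesis .
qed

text \<open>In the coordinate that sends the fixed point \<zeta> to infinity \<open>mo\<close> is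
  affine; it preserves the right half-plane, so the factor is real and the translation imaginary.
  Both are computed from the fixed point equation.\<close>

lemma cayley_mo:
  assumes \<zeta>: "norm \<zeta> = 1" "mo \<zeta> = \<zeta>" and z: "norm z < 1"
  shows "cayley \<zeta> (mo z) =
    of_real (mult \<zeta>) * cayley \<zeta> z + \<i> * of_real (- 2 * Im (1 - cnj b * \<zeta>) / (1 - (norm b)\<^sup>2))"
proof -
  define u where "u = 1 - cnj b * \<zeta>"
  define w where "w = mo z"
  define N where "N = 1 - b * cnj b"
  have N: "N = of_real (1 - (norm b)\<^sup>2)" unfolding N_def of_real_diff complex_norm_square by simp
  have N0: "N \<noteq> 0" using norm_b_pos unfolding N of_real_eq_0_iff by linarith
  have zz: "\<zeta> * cnj \<zeta> = 1" using \<zeta>(1) by (metis complex_norm_square of_real_1 one_power2)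
  have \<zeta>0: "\<zeta> \<noteq> 0" using \<zeta>(1) by auto
  have ub: "cnj u = 1 - b * cnj \<zeta>" by (simp add: u_def)
  have A: "\<zeta> * cnj u = \<zeta> - b" unfolding ub using zz by (simp add: algebra_simps)
  have u0: "u \<noteq> 0" using denom_nonzero \<zeta>(1) by (simp add: u_def)
  have "c * (\<zeta> - b) = \<zeta> * u"
    using \<zeta>(2) u0 by (simp add: mo_def u_def[symmetric] divide_eq_eq)
  then have "\<zeta> * (c * cnj u) = \<zeta> * u" using A by (metis mult.left_commute)
  \<comment> \<open>The fixed point equation in terms of \<open>u\<close>, which eliminates
    \<open>c\<close> below.\<close>
  then have B: "c * cnj u = u" using \<zeta>0 by simp
  have dz: "1 - cnj b * z \<noteq> 0" using denom_nonzero z by simp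
  have w: "w * (1 - cnj b * z) = c * (z - b)" using dz by (simp add: w_def mo_def)
  have "cnj u * ((\<zeta> - w) * (1 - cnj b * z)) = (\<zeta> * cnj u) * (1 - cnj b * z) - cnj u * (w * (1 - cnj b * z))"
    by (simp add: algebra_simps)
  also have "\<dots> = (\<zeta> - b) * (1 - cnj b * z) - u * (z - b)"
    unfolding A w using B by (metis mult.assoc mult.commute)
  also have "\<dots> = (\<zeta> - z) * N" by (simp add: u_def N_def algebra_simps)
  finally have C: "cnj u * ((\<zeta> - w) * (1 - cnj b * z)) = (\<zeta> - z) * N" .
  have \<zeta>z: "\<zeta> - z \<noteq> 0" using \<zeta>(1) z by auto
  then have \<zeta>w: "\<zeta> - w \<noteq> 0" using C N0 by auto
  have b\<zeta>: "\<zeta> * cnj b = 1 - u" "b * cnj \<zeta> = 1 - cnj u" by (simp_all add: u_def)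
  have bb: "b * cnj b = (1 - u) * (1 - cnj u)"
    using zz unfolding b\<zeta>[symmetric] by (simp add: mult_ac)
  have D: "u * cnj u - N + 2 * cnj u * (1 - u) = cnj u - u"
    unfolding N_def bb by (simp add: algebra_simps)
  \<comment> \<open>The coordinate is affine in \<open>1 / (\<zeta> - x)\<close>, so it is enough to
    transform this quantity.\<close>
  have cay: "cayley \<zeta> x = 2 * \<zeta> / (\<zeta> - x) - 1" if "\<zeta> - x \<noteq> 0" for x
    using that by (simp add: cayley_def field_simps)
  have "1 / (\<zeta> - w) = cnj u * (1 - cnj b * z) / ((\<zeta> - z) * N)"
    using C \<zeta>w \<zeta>z N0 by (simp add: field_simps)
  also have "\<dots> = cnj u * (u + cnj b * (\<zeta> - z)) / ((\<zeta> - z) * N)"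
    by (simp add: u_def algebra_simps)
  also have "\<dots> = (u * cnj u / N) * (1 / (\<zeta> - z)) + cnj u * cnj b / N"
    using \<zeta>z N0 by (simp add: divide_simps) (simp add: algebra_simps)
  finally have E: "1 / (\<zeta> - w) = (u * cnj u / N) * (1 / (\<zeta> - z)) + cnj u * cnj b / N" .
  have "cayley \<zeta> w = 2 * \<zeta> * (1 / (\<zeta> - w)) - 1" using cay[OF \<zeta>w] by simp
  also have "\<dots> = (u * cnj u / N) * (2 * \<zeta> / (\<zeta> - z) - 1)
      + (u * cnj u - N + 2 * cnj u * (\<zeta> * cnj b)) / N"
    unfolding E using N0 by (simp add: diff_divide_distrib add_divide_distrib algebra_simps)
  also have "\<dots> = (u * cnj u / N) * cayley \<zeta> z + (cnj u - u) / N"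
    unfolding b\<zeta>(1) D cay[OF \<zeta>z] ..
  also have "u * cnj u / N = of_real (mult \<zeta>)"
    unfolding N mult_def u_def[symmetric] of_real_divide complex_norm_square ..
  also have "(cnj u - u) / N = \<i> * of_real (- 2 * Im u / (1 - (norm b)\<^sup>2))"
    unfolding N of_real_divide times_divide_eq_right by (rule arg_cong2[of _ _ _ _ "(/)"]) (simp_all add: complex_eq_iff)
  finally show ?thesis by (simp add: w_def u_def)
qed

text \<open>The fixed points are the roots of a quadratic polynomial, and the product of the roots
  has modulus 1; with none inside the disc, both lie on the circle. The multipliers are inverse to
  each other because \<open>(1 - cnj b * z1) * (1 - cnj b * z2) = c * (1 - b * cnj b)\<close>. The
  two points may coincide.\<close>

lemma fixed_points:
  assumes "\<And>z. norm z < 1 \<Longrightarrow> mo z \<noteq> z"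
  obtains \<zeta>1 \<zeta>2 where "norm \<zeta>1 = 1" "norm \<zeta>2 = 1" "mult \<zeta>1 * mult \<zeta>2 = 1"
    "{\<zeta>. norm \<zeta> = 1 \<and> mo \<zeta> = \<zeta>} = {\<zeta>1, \<zeta>2}"
proof -
  \<comment> \<open>For \<open>b = 0\<close> the map would be a rotation and fix 0.\<close>
  have b0: "b \<noteq> 0" using assms[of 0] by (auto simp: mo_def)
  define s where "s = csqrt ((1 - c)\<^sup>2 + 4 * cnj b * c * b)"
  have s2: "s * s = (1 - c) * (1 - c) + 4 * cnj b * c * b"
    unfolding s_def using power2_csqrt by (simp flip: power2_eq_square)
  define z1 where "z1 = (1 - c + s) / (2 * cnj b)"
  define z2 where "z2 = (1 - c - s) / (2 * cnj b)"
  have sum: "cnj b * (z1 + z2) = 1 - c" using b0 by (simp add: z1_def z2_def field_simps)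
  have "(2 * cnj b * z1) * (2 * cnj b * z2) = (1 - c + s) * (1 - c - s)"
    using b0 by (simp add: z1_def z2_def)
  also have "\<dots> = (1 - c) * (1 - c) - s * s" by (simp add: algebra_simps)
  also have "\<dots> = 4 * cnj b * (- c * b)" unfolding s2 by simp
  finally have "(4 * cnj b) * (cnj b * (z1 * z2)) = (4 * cnj b) * (- c * b)" by (simp add: mult_ac)
  then have prod: "cnj b * (z1 * z2) = - c * b" using b0 by (subst (asm) mult_left_cancel) auto
  have fac: "cnj b * z\<^sup>2 + (c - 1) * z - c * b = cnj b * ((z - z1) * (z - z2))" for z
  proof -
    have "cnj b * ((z - z1) * (z - z2)) = cnj b * z\<^sup>2 - (cnj b * (z1 + z2)) * z + cnj b * (z1 * z2)"
      by (simp add: power2_eq_square algebra_simps)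
    then show ?thesis unfolding sum prod by (simp add: algebra_simps)
  qed
  have fix_iff: "mo z = z \<longleftrightarrow> z = z1 \<or> z = z2" if "norm z \<le> 1" for z
    using fixed_iff[OF that] fac b0 by simp
  have "norm b * (norm z1 * norm z2) = norm b"
    using arg_cong[OF prod, of norm] c by (simp add: norm_mult)
  then have n12: "norm z1 * norm z2 = 1" using b0 by simp
  have ge: "norm z1 \<ge> 1" "norm z2 \<ge> 1" using assms[of z1] assms[of z2] fix_iff[of z1] fix_iff[of z2] by (auto simp: not_le[symmetric])
  have n1: "norm z1 = 1" "norm z2 = 1"
  proof -
    have "norm z1 * 1 \<le> norm z1 * norm z2" "1 * norm z2 \<le> norm z1 * norm z2"
      using ge by (intro mult_left_mono mult_right_mono; simp)+
    then show "norm z1 = 1" "norm z2 = 1" using ge n12 by linarith+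
  qed
  have "(1 - cnj b * z1) * (1 - cnj b * z2) = 1 - cnj b * (z1 + z2) + cnj b * (cnj b * (z1 * z2))"
    by (simp add: algebra_simps)
  also have "\<dots> = c * (1 - b * cnj b)" unfolding sum prod by (simp add: algebra_simps)
  finally have "norm (1 - cnj b * z1) * norm (1 - cnj b * z2) = norm (1 - b * cnj b)"
    using c by (metis mult_1 norm_mult)
  also have "1 - b * cnj b = of_real (1 - (norm b)\<^sup>2)"
    unfolding of_real_diff complex_norm_square by simp
  finally have "norm (1 - cnj b * z1) * norm (1 - cnj b * z2) = 1 - (norm b)\<^sup>2"
    using norm_b_pos by (simp add: abs_of_pos del: of_real_diff of_real_power)
  then have "(norm (1 - cnj b * z1))\<^sup>2 * (norm (1 - cnj b * z2))\<^sup>2 = (1 - (norm b)\<^sup>2)\<^sup>2"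
    by (metis power_mult_distrib)
  then have "mult z1 * mult z2 = 1"
    using norm_b_pos by (simp add: mult_def power2_eq_square)
  moreover have "{\<zeta>. norm \<zeta> = 1 \<and> mo \<zeta> = \<zeta>} = {z1, z2}" using fix_iff n1 by auto
  ultimately show ?thesis using that n1 by blast
qed

text \<open>\<open>mo\<close> is continuous at every point of the circle, so its limit there from
  inside the disc is its value.\<close>

lemma boundary_fixed_points_mo:
  assumes "\<And>z. z \<in> unit_disc \<Longrightarrow> g z = mo z"
  shows "boundary_fixed_points g = {\<zeta>. norm \<zeta> = 1 \<and> mo \<zeta> = \<zeta>}"
proof -
  have lim: "(g \<longlongrightarrow> mo \<zeta>) (at \<zeta> within unit_disc)" if "norm \<zeta> = 1" for \<zeta>
  proof -
    have "(mo \<longlongrightarrow> mo \<zeta>) (at \<zeta> within unit_disc)"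
      unfolding mo_def using denom_nonzero[of \<zeta>] that by (intro tendsto_intros) auto
    then show ?thesis
      by (rule Lim_transform_eventually) (use assms in \<open>auto simp: eventually_at_filter\<close>)
  qed
  have nt: "at \<zeta> within unit_disc \<noteq> bot" if "norm \<zeta> = 1" for \<zeta> :: complex
  proof -
    have "\<zeta> islimpt unit_disc" using that by (simp add: islimpt_ball)
    then show ?thesis by (simp add: trivial_limit_within)
  qed
  show ?thesis
    unfolding boundary_fixed_points_def using lim nt tendsto_unique by fastforce
qed

end

section \<open>Lengths of radial images\<close>

lemma DERIV_hyperbolic_length:
  assumes "0 \<le> t" "t < 1"
  shows "(hyperbolic_length has_real_derivative 2 / (1 - t\<^sup>2)) (at t)"
proof -
  have "((\<lambda>r. ln (1 + r) - ln (1 - r)) has_real_derivative (1 / (1 + t) + 1 / (1 - t))) (at t)"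
    using assms by (auto intro!: derivative_eq_intros)
  also have "1 / (1 + t) + 1 / (1 - t) = 2 / (1 - t\<^sup>2)"
  proof -
    have "1 + t \<noteq> 0" "1 - t \<noteq> 0" using assms by auto
    moreover have "1 - t\<^sup>2 = (1 + t) * (1 - t)" by (simp add: power2_eq_square algebra_simps)
    ultimately show ?thesis by (simp add: add_frac_eq)
  qed
  finally show ?thesis
    by (rule has_field_derivative_transform_within_open[of _ _ _ "{-1<..<1}"])
      (use assms in \<open>auto simp: hyperbolic_length_def ln_div\<close>)
qed

lemma hyperbolic_length_0: "hyperbolic_length 0 = 0"
  by (simp add: hyperbolic_length_def)

text \<open>Passage between \<open>1 / (1 - t)\<close>, which comes from the Schwarz estimates, and
  the density of the hyperbolic length.\<close>

lemma inverse_one_minus_bounds: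
  fixes t :: real
  assumes "0 \<le> t" "t < 1"
  shows "1 / (1 - t) \<le> 2 / (1 - t\<^sup>2)" "1 / (1 - t\<^sup>2) \<le> 1 / (1 - t)"
proof -
  have eq: "1 - t\<^sup>2 = (1 - t) * (1 + t)" by (simp add: power2_eq_square algebra_simps)
  have "1 / (1 - t) \<le> 1 / (1 - t) * (2 / (1 + t))"
    using assms mult_left_mono[of 1 "2 / (1 + t)" "1 / (1 - t)"] by simp
  then show "1 / (1 - t) \<le> 2 / (1 - t\<^sup>2)" unfolding eq by simp
  have "1 / (1 - t) * (1 / (1 + t)) \<le> 1 / (1 - t)"
    using assms by (intro mult_left_le) auto
  then show "1 / (1 - t\<^sup>2) \<le> 1 / (1 - t)" unfolding eq by simp
qed

section \<open>The half-plane coordinate on radii and under iteration\<close>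

lemma cayley_radius:
  assumes "norm \<omega> = 1"
  shows "cayley \<omega> (of_real t * \<omega>) = of_real ((1 + t) / (1 - t))"
proof -
  have "\<omega> \<noteq> 0" using assms by auto
  have "cayley \<omega> (of_real t * \<omega>) = (\<omega> * (1 + of_real t)) / (\<omega> * (1 - of_real t))"
    by (simp add: cayley_def algebra_simps)
  also have "\<dots> = of_real ((1 + t) / (1 - t))" using \<open>\<omega> \<noteq> 0\<close> by simp
  finally show ?thesis .
qed

lemma cayley_inverse:
  assumes "norm \<omega> = 1" "norm z < 1"
  shows "z = \<omega> * ((cayley \<omega> z - 1) / (cayley \<omega> z + 1))"
proof -
  have "\<omega> - z \<noteq> 0" "\<omega> \<noteq> 0" using assms by auto
  then have "cayley \<omega> z - 1 = 2 * z / (\<omega> - z)" "cayley \<omega> z + 1 = 2 * \<omega> / (\<omega> - z)"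
    by (simp_all add: cayley_def field_simps)
  then show ?thesis using \<open>\<omega> - z \<noteq> 0\<close> \<open>\<omega> \<noteq> 0\<close> by simp
qed

lemma norm_cayley_inverse_lt_1:
  assumes "Re u > 0"
  shows "norm ((u - 1) / (u + 1)) < 1"
  using half_plane_quotient_lt_1[of u 1] assms by simp

text \<open>A large value of the coordinate means that its denominator \<open>\<omega> - z\<close>
  is small.\<close>

lemma dist_le_of_cayley:
  assumes "norm \<omega> = 1" "norm z < 1"
  shows "norm (\<omega> - z) * norm (cayley \<omega> z) \<le> 2"
proof -
  have "\<omega> - z \<noteq> 0" using assms by auto
  then have "norm (\<omega> - z) * norm (cayley \<omega> z) = norm (\<omega> + z)"
    by (simp add: cayley_def norm_divide)
  also have "\<dots> \<le> 2" using norm_triangle_ineq[of \<omega> z] assms by simp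
  finally show ?thesis .
qed

lemma funpow_affine:
  assumes \<phi>: "\<And>z. z \<in> S \<Longrightarrow> \<phi> z \<in> S"
    and aff: "\<And>z. z \<in> S \<Longrightarrow> H (\<phi> z) = of_real \<kappa> * H z + \<i> * of_real \<beta>" and z: "z \<in> S"
  shows "(\<phi> ^^ n) z \<in> S" "Re (H ((\<phi> ^^ n) z)) = \<kappa> ^ n * Re (H z)"
    "Im (H ((\<phi> ^^ Suc n) z)) = \<kappa> * Im (H ((\<phi> ^^ n) z)) + \<beta>"
proof -
  have S: "(\<phi> ^^ n) z \<in> S" for n by (induction n) (use \<phi> z in auto)
  show "(\<phi> ^^ n) z \<in> S" by fact
  show "Re (H ((\<phi> ^^ n) z)) = \<kappa> ^ n * Re (H z)"
    by (induction n) (use aff[OF S] in auto)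
  show "Im (H ((\<phi> ^^ Suc n) z)) = \<kappa> * Im (H ((\<phi> ^^ n) z)) + \<beta>"
    using aff[OF S[of n]] by simp
qed

lemma eighth_root_power:
  fixes x :: real
  assumes "x \<ge> 0"
  shows "(x ^ 8) powr (1/8) = x"
proof (cases "x = 0")
  case False
  then have "x ^ 8 = x powr 8" using assms powr_realpow[of x 8] by simp
  then have "(x ^ 8) powr (1/8) = (x powr 8) powr (1/8)" by (rule arg_cong)
  also have "\<dots> = x powr (8 * (1/8))" by (rule powr_powr)
  also have "\<dots> = x" using assms by simp
  finally show ?thesis .
qed simp

text \<open>The least \<open>n\<close> with \<open>\<kappa> ^ n * x \<le> 1\<close> works: the
  exponent before it, if any, still gives a value above 1.\<close>

lemma power_in_window:
  fixes \<kappa> x :: real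
  assumes "0 < \<kappa>" "\<kappa> < 1" "1 \<le> x"
  obtains n where "\<kappa> \<le> \<kappa> ^ n * x" "\<kappa> ^ n * x \<le> 1"
proof -
  obtain m where "\<kappa> ^ m < 1 / x" using real_arch_pow_inv[of "1/x" \<kappa>] assms by auto
  then have m: "\<kappa> ^ m * x \<le> 1" using assms by (simp add: field_simps)
  define n where "n = (LEAST n. \<kappa> ^ n * x \<le> 1)"
  have n: "\<kappa> ^ n * x \<le> 1" unfolding n_def using m by (rule LeastI)
  have "\<kappa> \<le> \<kappa> ^ n * x"
  proof (cases n)
    case 0
    then show ?thesis using assms by simp
  next
    case (Suc k)
    then have "\<not> \<kappa> ^ k * x \<le> 1" using not_less_Least[of k "\<lambda>n. \<kappa> ^ n * x \<le> 1"] by (simp add: n_def)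
    then have "\<kappa> * 1 \<le> \<kappa> * (\<kappa> ^ k * x)" using assms by (intro mult_left_mono) auto
    then show ?thesis using Suc by simp
  qed
  then show ?thesis using n that by blast
qed

section \<open>Estimates of the radial length by integration\<close>

context graph_domain
begin

lemma continuous_on_radial_speed:
  assumes "r < 1"
  shows "continuous_on {0..r} (\<lambda>t. norm (deriv f (of_real t * cis \<theta>)))"
proof -
  have "continuous_on unit_disc (deriv f)"
    using holo by (intro holomorphic_on_imp_continuous_on holomorphic_deriv) auto
  then have "continuous_on {0..r} (\<lambda>t. deriv f (of_real t * cis \<theta>))"
    by (rule continuous_on_compose2) (use assms in \<open>auto intro!: continuous_intros simp: norm_mult\<close>)
  then show ?thesis by (rule continuous_on_norm)
qed

lemma euclidean_length_has_integral:
  assumes "r < 1"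
  shows "((\<lambda>t. norm (deriv f (of_real t * cis \<theta>))) has_integral euclidean_length f r \<theta>) {0..r}"
  unfolding euclidean_length_def
  by (intro integrable_integral integrable_continuous_real continuous_on_radial_speed assms)

lemma antiderivative_has_integral:
  fixes B b :: "real \<Rightarrow> real"
  assumes "0 \<le> r" "r < 1" "\<And>t. 0 \<le> t \<Longrightarrow> t < 1 \<Longrightarrow> (B has_real_derivative b t) (at t)"
  shows "(b has_integral B r - B 0) {0..r}"
  using assms by (intro fundamental_theorem_of_calculus)
    (auto simp: has_real_derivative_iff_has_vector_derivative[symmetric] intro: has_field_derivative_at_within)

lemma euclidean_length_le:
  assumes "0 \<le> r" "r < 1" "\<And>t. 0 \<le> t \<Longrightarrow> t < 1 \<Longrightarrow> (B has_real_derivative b t) (at t)"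
    and "\<And>t. 0 \<le> t \<Longrightarrow> t < 1 \<Longrightarrow> norm (deriv f (of_real t * cis \<theta>)) \<le> b t"
  shows "euclidean_length f r \<theta> \<le> B r - B 0"
  by (rule has_integral_le[OF euclidean_length_has_integral[OF assms(2)] antiderivative_has_integral[OF assms(1-3)]])
    (use assms in auto)

lemma euclidean_length_ge:
  assumes "0 \<le> r" "r < 1" "\<And>t. 0 \<le> t \<Longrightarrow> t < 1 \<Longrightarrow> (B has_real_derivative b t) (at t)"
    and "\<And>t. 0 \<le> t \<Longrightarrow> t < 1 \<Longrightarrow> b t \<le> norm (deriv f (of_real t * cis \<theta>))"
  shows "B r - B 0 \<le> euclidean_length f r \<theta>"
  by (rule has_integral_le[OF antiderivative_has_integral[OF assms(1-3)] euclidean_length_has_integral[OF assms(2)]])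
    (use assms in auto)

lemma euclidean_length_nonneg: "r < 1 \<Longrightarrow> 0 \<le> euclidean_length f r \<theta>"
  by (rule has_integral_nonneg[OF euclidean_length_has_integral]) auto

lemma euclidean_length_bigo:
  assumes "\<And>r. 0 < r \<Longrightarrow> r < 1 \<Longrightarrow> euclidean_length f r \<theta> \<le> c * g r"
  shows "(\<lambda>r. euclidean_length f r \<theta>) \<in> O[at_left 1](g)"
proof (rule bigoI[of _ "\<bar>c\<bar>"])
  have "norm (euclidean_length f r \<theta>) \<le> \<bar>c\<bar> * norm (g r)" if "r \<in> {0<..<1}" for r
  proof -
    have "norm (euclidean_length f r \<theta>) \<le> c * g r"
      using assms euclidean_length_nonneg that by simp
    also have "\<dots> \<le> \<bar>c\<bar> * norm (g r)" by (metis abs_ge_self abs_mult real_norm_def)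
    finally show ?thesis .
  qed
  moreover have "\<forall>\<^sub>F r in at_left (1::real). r \<in> {0<..<1}" by (rule eventually_at_left_real) simp
  ultimately show "\<forall>\<^sub>F r in at_left 1. norm (euclidean_length f r \<theta>) \<le> \<bar>c\<bar> * norm (g r)"
    by (rule eventually_mono[rotated])
qed

lemma radius_in_disc: "0 \<le> t \<Longrightarrow> t < 1 \<Longrightarrow> of_real t * cis \<theta> \<in> unit_disc"
  by (simp add: norm_mult)

lemma length_bigo_hyperbolic: "(\<lambda>r. euclidean_length f r \<theta>) \<in> O[at_left 1](hyperbolic_length)"
proof -
  obtain M where M: "M > 0" "\<And>z. z \<in> unit_disc \<Longrightarrow> norm (deriv f z) * (1 - norm z) \<le> M"
    using deriv_bound by blast
  have "euclidean_length f r \<theta> \<le> M * hyperbolic_length r - M * hyperbolic_length 0" if r: "0 < r" "r < 1" for r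
  proof (rule euclidean_length_le)
    fix t :: real assume t: "0 \<le> t" "t < 1"
    show "((\<lambda>t. M * hyperbolic_length t) has_real_derivative M * (2 / (1 - t\<^sup>2))) (at t)"
      by (intro DERIV_cmult DERIV_hyperbolic_length t)
    have "norm (deriv f (of_real t * cis \<theta>)) * (1 - t) \<le> M"
      using M(2)[OF radius_in_disc[OF t]] t by (simp add: norm_mult)
    then have "norm (deriv f (of_real t * cis \<theta>)) \<le> M * (1 / (1 - t))" using t by (simp add: field_simps)
    also have "\<dots> \<le> M * (2 / (1 - t\<^sup>2))"
      using M inverse_one_minus_bounds(1)[OF t] by (intro mult_left_mono) auto
    finally show "norm (deriv f (of_real t * cis \<theta>)) \<le> M * (2 / (1 - t\<^sup>2))" .
  qed (use r in auto)
  then show ?thesis by (intro euclidean_length_bigo[of _ M]) (simp add: hyperbolic_length_0)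
qed

lemma length_bounded_off_limit_set:
  assumes "cis \<theta> \<notin> limit_set (deck_group f)"
  shows "(\<lambda>r. euclidean_length f r \<theta>) \<in> O[at_left 1](\<lambda>_. 1)"
proof -
  obtain K M where K: "compact K" "K \<subseteq> D" "M > 0" "\<And>z. z \<in> unit_disc \<Longrightarrow> poisson_decay K M z"
    using poisson_decay_global by blast
  define \<omega> where "\<omega> = cis \<theta>"
  have \<omega>: "norm \<omega> = 1" by (simp add: \<omega>_def)
  obtain e where e: "e > 0" "\<And>z. z \<in> unit_disc \<Longrightarrow> f z \<in> K \<Longrightarrow> dist z \<omega> \<ge> e"
    using compact_preimage_away_from_regular_point[OF \<omega> _ K(1,2)] assms by (metis \<omega>_def)
  obtain B where B: "B > 0" "\<And>z q. z \<in> unit_disc \<Longrightarrow> q \<in> frontier D \<Longrightarrow>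
      norm (deriv f z) * (1 - norm z) \<le> B * sqrt (norm (f z - q))"
    using deriv_bound_frontier by blast
  \<comment> \<open>This bounds \<open>M\<close> times the Poisson kernel at points at distance at
    least \<open>e\<close> from \<omega>, the numerator of the kernel being at most 1.\<close>
  define C where "C = M / e\<^sup>2"
  have C: "C > 0" using K e by (simp add: C_def)
  define A where "A = B * C powr (1/8)"
  have A: "A > 0" using B C by (simp add: A_def)
  have speed: "norm (deriv f (of_real t * cis \<theta>)) \<le> A * (1 - t) powr (-7/8)" if t: "0 \<le> t" "t < 1" for t
  proof -
    define z where "z = of_real t * \<omega>"
    have z: "z \<in> unit_disc" "norm z = t" using t \<omega> by (simp_all add: z_def norm_mult)
    obtain q z' where q: "q \<in> frontier D" "z' \<in> unit_disc" "f z' \<in> K"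
      "Re (cayley \<omega> z) * norm (f z - q) ^ 4 \<le> M * Re (cayley \<omega> z')"
      using K(4)[OF z(1)] \<omega> unfolding poisson_decay_def by blast
    define X where "X = norm (f z - q)"
    have "Re (cayley \<omega> z') \<le> 1 / e\<^sup>2"
    proof -
      have "e \<le> norm (\<omega> - z')" using e(2)[OF q(2,3)] by (simp add: dist_norm norm_minus_commute)
      then have "e\<^sup>2 \<le> (norm (\<omega> - z'))\<^sup>2" using e(1) by (intro power_mono) auto
      then show ?thesis unfolding Re_cayley[OF \<omega>] using e(1) by (intro frac_le) auto
    qed
    then have "M * Re (cayley \<omega> z') \<le> C"
      using K(3) mult_left_mono[of _ "1 / e\<^sup>2" M] by (simp add: C_def)
    with q(4) have "(1 + t) / (1 - t) * X ^ 4 \<le> C"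
      unfolding z_def cayley_radius[OF \<omega>] Re_complex_of_real X_def by linarith
    moreover have "1 / (1 - t) * X ^ 4 \<le> (1 + t) / (1 - t) * X ^ 4"
      using t by (intro mult_right_mono divide_right_mono) (auto simp: X_def)
    ultimately have "1 / (1 - t) * X ^ 4 \<le> C" by linarith
    then have X4: "X ^ 4 \<le> C * (1 - t)" using t by (simp add: field_simps)
    \<comment> \<open>The fourth power of the distance \<open>X\<close> is \<open>O(1 - t)\<close>,
      and \<open>X\<close> enters the derivative bound under a square root, whence the exponent
      1/8.\<close>
    have "sqrt X = (sqrt X ^ 8) powr (1/8)"
      by (rule eighth_root_power[symmetric]) (simp add: X_def)
    also have "sqrt X ^ 8 = X ^ 4"
      using power_mult[of "sqrt X" 2 4] by (simp add: X_def)
    also have "(X ^ 4) powr (1/8) \<le> (C * (1 - t)) powr (1/8)"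
      using X4 by (intro powr_mono2) (auto simp: X_def)
    also have "\<dots> = C powr (1/8) * (1 - t) powr (1/8)" using C t by (simp add: powr_mult)
    finally have sX: "sqrt X \<le> C powr (1/8) * (1 - t) powr (1/8)" .
    have "norm (deriv f z) * (1 - t) \<le> B * sqrt X" using B(2)[OF z(1) q(1)] z(2) by (simp add: X_def)
    also have "\<dots> \<le> A * (1 - t) powr (1/8)"
      using mult_left_mono[OF sX, of B] B(1) by (simp add: A_def mult_ac)
    finally have "norm (deriv f z) \<le> A * ((1 - t) powr (1/8) / (1 - t))" using t by (simp add: field_simps)
    also have "(1 - t) powr (1/8) / (1 - t) = (1 - t) powr (-7/8)"
      using t powr_diff[of "1 - t" "1/8" 1] by simp
    finally show ?thesis by (simp add: z_def \<omega>_def)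
  qed
  have "euclidean_length f r \<theta> \<le> 8 * A * 1" if r: "0 < r" "r < 1" for r
  proof -
    \<comment> \<open>The antiderivative of the speed bound stays bounded up to
      \<open>t = 1\<close>.\<close>
    have "euclidean_length f r \<theta> \<le> - 8 * A * (1 - r) powr (1/8) - (- 8 * A * (1 - 0) powr (1/8))"
    proof (rule euclidean_length_le)
      fix t :: real assume t: "0 \<le> t" "t < 1"
      have p: "((\<lambda>x. x powr (1/8)) has_real_derivative (1/8) * (1 - t) powr (1/8 - 1)) (at (1 - t))"
        using t by (intro has_real_derivative_powr) auto
      have l: "((\<lambda>t. 1 - t) has_real_derivative - 1) (at t)" by (auto intro!: derivative_eq_intros)
      have "((\<lambda>t. (1 - t) powr (1/8)) has_real_derivative (1/8) * (1 - t) powr (1/8 - 1) * (- 1)) (at t)"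
        by (rule DERIV_chain2[where f = "\<lambda>x. x powr (1/8)" and g = "\<lambda>t. 1 - t", OF p l])
      then have "((\<lambda>t. - 8 * A * (1 - t) powr (1/8)) has_real_derivative
          - 8 * A * ((1/8) * (1 - t) powr (1/8 - 1) * (- 1))) (at t)"
        by (rule DERIV_cmult)
      then show "((\<lambda>t. - 8 * A * (1 - t) powr (1/8)) has_real_derivative A * (1 - t) powr (-7/8)) (at t)"
        by simp
    qed (use r speed in auto)
    also have "\<dots> \<le> 8 * A * 1" using A by simp
    finally show ?thesis .
  qed
  then show ?thesis by (intro euclidean_length_bigo[of _ "8 * A"]) simp
qed

section \<open>Deck transformations, their boundary fixed points and the limit set\<close>

lemma deck_moebius:
  assumes "g \<in> deck_group f"
  shows "\<exists>c b. moebius c b \<and> (\<forall>z\<in>unit_disc. g z = moebius.mo c b z)"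
proof -
  obtain h where h: "g holomorphic_on unit_disc" "h holomorphic_on unit_disc"
    "\<forall>z\<in>unit_disc. g z \<in> unit_disc \<and> h z \<in> unit_disc \<and> h (g z) = z \<and> g (h z) = z"
    using deck_inverse[OF assms] by blast
  have "\<exists>c b. norm c = 1 \<and> norm b < 1 \<and> (\<forall>z\<in>unit_disc. g z = c * (z - b) / (1 - cnj b * z))"
    by (rule disc_automorphism_moebius[of g h]) (use h in blast)+
  then obtain c b where cb: "norm c = 1" "norm b < 1" "\<forall>z\<in>unit_disc. g z = c * (z - b) / (1 - cnj b * z)"
    by blast
  then have "moebius c b" by unfold_locales
  then show ?thesis using cb(3) by (intro exI[of _ c] exI[of _ b]) (simp add: moebius.mo_def)
qed

text \<open>A deck transformation acting as a translation in the half-plane coordinate at \<open>\<zeta>\<close> (a parabolic one)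
  would move the points of the radius at \<open>\<zeta>\<close> by \<open>O((1 - t)\<^sup>2)\<close>.\<close>
lemma deck_multiplier_ne_1:
  assumes g: "g \<in> deck_group f" and nofix: "\<And>z. z \<in> unit_disc \<Longrightarrow> g z \<noteq> z" and \<zeta>: "norm \<zeta> = 1"
    and aff: "\<And>z. z \<in> unit_disc \<Longrightarrow> cayley \<zeta> (g z) = of_real \<kappa> * cayley \<zeta> z + \<i> * of_real \<beta>"
  shows "\<kappa> \<noteq> 1"
proof
  assume "\<kappa> = 1"
  obtain d where d: "d > 0" "\<And>g z. g \<in> deck_group f \<Longrightarrow> z \<in> unit_disc \<Longrightarrow> g z \<noteq> z \<Longrightarrow>
    norm (g z - z) \<ge> d * (1 - norm z)" using deck_displacement by blast
  have gd: "g z \<in> unit_disc" if "z \<in> unit_disc" for z using deck_inverse[OF g] that by blast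
  have "d * (x + 1) \<le> \<bar>\<beta>\<bar>" if x: "x \<ge> 1" for x
  proof -
    \<comment> \<open>The point of the radius whose half-plane coordinate is the real number
      \<open>x\<close>.\<close>
    define z where "z = of_real ((x - 1) / (x + 1)) * \<zeta>"
    have nz: "norm z = (x - 1) / (x + 1)" unfolding z_def norm_mult norm_of_real using x \<zeta> by simp
    then have "norm z < 1" using x by simp
    then have z: "z \<in> unit_disc" by simp
    have "(1 + (x - 1) / (x + 1)) / (1 - (x - 1) / (x + 1)) = x" using x by (simp add: field_simps)
    then have cz: "cayley \<zeta> z = of_real x" unfolding z_def cayley_radius[OF \<zeta>] by simp
    define u where "u = of_real x + \<i> * of_real \<beta>"
    have cg: "cayley \<zeta> (g z) = u" using aff[OF z] cz \<open>\<kappa> = 1\<close> by (simp add: u_def)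
    have u1: "u + 1 \<noteq> 0" using x by (auto simp: u_def complex_eq_iff)
    have x1: "of_real x + 1 \<noteq> (0::complex)" using x by (auto simp: complex_eq_iff)
    have "g z - z = \<zeta> * ((u - 1) / (u + 1)) - \<zeta> * ((of_real x - 1) / (of_real x + 1))"
      using cayley_inverse[OF \<zeta>, of "g z"] cayley_inverse[OF \<zeta>, of z] gd[OF z] z cg cz by simp
    also have "\<dots> = \<zeta> * (2 * (u - of_real x)) / ((u + 1) * (of_real x + 1))"
      using u1 x1 by (simp add: field_simps)
    also have "u - of_real x = \<i> * of_real \<beta>" by (simp add: u_def)
    finally have gz: "g z - z = \<zeta> * (2 * (\<i> * of_real \<beta>)) / ((u + 1) * (of_real x + 1))" .
    have "norm (of_real (x + 1) :: complex) = x + 1" unfolding norm_of_real using x by simp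
    then have "norm (g z - z) = 2 * \<bar>\<beta>\<bar> / (norm (u + 1) * (x + 1))"
      unfolding gz using \<zeta> by (simp add: norm_divide norm_mult)
    also have "\<dots> \<le> 2 * \<bar>\<beta>\<bar> / ((x + 1) * (x + 1))"
    proof (intro divide_left_mono mult_right_mono)
      show "x + 1 \<le> norm (u + 1)" using complex_Re_le_cmod[of "u + 1"] by (simp add: u_def)
    qed (use x u1 in auto)
    finally have "d * (1 - norm z) \<le> 2 * \<bar>\<beta>\<bar> / ((x + 1) * (x + 1))"
      using d(2)[OF g z nofix[OF z]] by linarith
    moreover have "1 - norm z = 2 / (x + 1)" unfolding nz using x by (simp add: field_simps)
    ultimately have le: "d * (2 / (x + 1)) \<le> 2 * \<bar>\<beta>\<bar> / ((x + 1) * (x + 1))" by simp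
    have *: "d * y \<le> k" if "y > 0" "d * (2 / y) \<le> 2 * k / (y * y)" for y k :: real
    proof -
      have "(d * (2 / y)) * (y * y) \<le> (2 * k / (y * y)) * (y * y)"
        using that by (intro mult_right_mono) auto
      then show ?thesis using that(1) by simp
    qed
    show ?thesis by (rule *[OF _ le]) (use x in simp)
  qed
  \<comment> \<open>For this \<open>x\<close> the left-hand side is
    \<open>\<bar>\<beta>\<bar> + 2 * d\<close>, which is too large.\<close>
  from this[of "\<bar>\<beta>\<bar> / d + 1"] show False using d(1) by (simp add: algebra_simps)
qed

text \<open>By uniqueness of lifts \<open>g\<close> has no fixed point in the disc, so the
  multipliers at its boundary fixed points have product 1. Neither equals 1 by
  \<open>deck_multiplier_ne_1\<close>; hence the two points are distinct and one multiplier exceeds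
  1.\<close>

lemma deck_hyperbolic:
  assumes g: "g \<in> deck_group f" and "z0 \<in> unit_disc" "g z0 \<noteq> z0"
  shows "hyperbolic g"
    and "\<And>\<zeta>. \<zeta> \<in> boundary_fixed_points g \<Longrightarrow> norm \<zeta> = 1 \<and> (\<exists>\<kappa> \<beta>. \<kappa> > 0 \<and> \<kappa> \<noteq> 1 \<and>
      (\<forall>z\<in>unit_disc. cayley \<zeta> (g z) = of_real \<kappa> * cayley \<zeta> z + \<i> * of_real \<beta>))"
    and "\<exists>\<zeta>\<in>boundary_fixed_points g. \<exists>\<kappa> \<beta>. \<kappa> > 1 \<and>
      (\<forall>z\<in>unit_disc. cayley \<zeta> (g z) = of_real \<kappa> * cayley \<zeta> z + \<i> * of_real \<beta>)"
proof -
  obtain c b where "moebius c b" and gm: "\<And>z. z \<in> unit_disc \<Longrightarrow> g z = moebius.mo c b z"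
    using deck_moebius[OF g] by blast
  interpret moebius c b by fact
  have nofix: "g z \<noteq> z" if "z \<in> unit_disc" for z
    using deck_fixed_point_imp_id[OF g that _ assms(2)] assms(3) by blast
  have nf: "mo z \<noteq> z" if "norm z < 1" for z using nofix[of z] gm[of z] that by simp
  have "\<exists>\<zeta>1 \<zeta>2. norm \<zeta>1 = 1 \<and> norm \<zeta>2 = 1 \<and> mult \<zeta>1 * mult \<zeta>2 = 1 \<and>
    {\<zeta>. norm \<zeta> = 1 \<and> mo \<zeta> = \<zeta>} = {\<zeta>1, \<zeta>2}"
    by (rule fixed_points[OF nf], assumption, intro exI conjI, assumption+)
  then obtain \<zeta>1 \<zeta>2 where Z: "norm \<zeta>1 = 1" "norm \<zeta>2 = 1" "mult \<zeta>1 * mult \<zeta>2 = 1"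
    "{\<zeta>. norm \<zeta> = 1 \<and> mo \<zeta> = \<zeta>} = {\<zeta>1, \<zeta>2}"
    by blast
  have bfp: "boundary_fixed_points g = {\<zeta>1, \<zeta>2}"
    using boundary_fixed_points_mo[OF gm] Z(4) by simp
  have aff: "\<exists>\<beta>. \<forall>z\<in>unit_disc. cayley \<zeta> (g z) = of_real (mult \<zeta>) * cayley \<zeta> z + \<i> * of_real \<beta>"
    if "\<zeta> \<in> {\<zeta>1, \<zeta>2}" for \<zeta>
  proof -
    have "norm \<zeta> = 1" "mo \<zeta> = \<zeta>" using that Z(4) by auto
    then show ?thesis using cayley_mo gm by (intro exI[of _ "- 2 * Im (1 - cnj b * \<zeta>) / (1 - (norm b)\<^sup>2)"]) simp
  qed
  have pos: "mult \<zeta>1 > 0" "mult \<zeta>2 > 0" using mult_pos Z by auto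
  have ne1: "mult \<zeta> \<noteq> 1" if "\<zeta> \<in> {\<zeta>1, \<zeta>2}" for \<zeta>
    using aff[OF that] deck_multiplier_ne_1[OF g nofix] that Z by blast
  show fp: "norm \<zeta> = 1 \<and> (\<exists>\<kappa> \<beta>. \<kappa> > 0 \<and> \<kappa> \<noteq> 1 \<and>
      (\<forall>z\<in>unit_disc. cayley \<zeta> (g z) = of_real \<kappa> * cayley \<zeta> z + \<i> * of_real \<beta>))"
    if "\<zeta> \<in> boundary_fixed_points g" for \<zeta>
    using that unfolding bfp using aff[of \<zeta>] ne1[of \<zeta>] pos Z by blast
  have "\<zeta>1 \<noteq> \<zeta>2"
  proof
    assume "\<zeta>1 = \<zeta>2"
    then have "(mult \<zeta>1)\<^sup>2 = 1" using Z(3) by (simp add: power2_eq_square)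
    then have "mult \<zeta>1 = 1" using pos(1) by (simp add: power2_eq_1_iff)
    then show False using ne1 by blast
  qed
  then have card: "card (boundary_fixed_points g) = 2" by (simp add: bfp)
  obtain h where h: "g holomorphic_on unit_disc"
    "\<forall>z\<in>unit_disc. g z \<in> unit_disc \<and> h z \<in> unit_disc \<and> h (g z) = z \<and> g (h z) = z"
    using deck_inverse[OF g] by blast
  have "bij_betw g unit_disc unit_disc"
    by (rule bij_betw_byWitness[of _ h]) (use h in blast)+
  then show "hyperbolic g" unfolding hyperbolic_def using h nofix card by blast
  have "mult \<zeta>1 > 1 \<or> mult \<zeta>2 > 1"
  proof (rule ccontr)
    assume "\<not> ?thesis"
    then have "mult \<zeta>1 < 1" "mult \<zeta>2 < 1" using ne1[of \<zeta>1] ne1[of \<zeta>2] by auto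
    then have "mult \<zeta>1 * mult \<zeta>2 < 1 * 1" using pos by (intro mult_strict_mono) auto
    then show False using Z by simp
  qed
  then show "\<exists>\<zeta>\<in>boundary_fixed_points g. \<exists>\<kappa> \<beta>. \<kappa> > 1 \<and>
      (\<forall>z\<in>unit_disc. cayley \<zeta> (g z) = of_real \<kappa> * cayley \<zeta> z + \<i> * of_real \<beta>)"
    unfolding bfp using aff by blast
qed

text \<open>\<open>g\<close> and its inverse act at \<zeta> with reciprocal factors, one above 1 and
  the other below. \<open>acts\<close> records what iteration uses and thus covers the inverse too,
  which may fail to be extensional.\<close>

lemma hyperbolic_fixed_point_maps:
  assumes "\<zeta> \<in> hyperbolic_fixed_points (deck_group f)"
  defines "acts \<equiv> \<lambda>\<phi> \<kappa>. \<exists>\<beta>. \<forall>z\<in>unit_disc. \<phi> z \<in> unit_disc \<and> f (\<phi> z) = f z \<and>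
      cayley \<zeta> (\<phi> z) = of_real \<kappa> * cayley \<zeta> z + \<i> * of_real \<beta>"
  shows "norm \<zeta> = 1" "\<exists>\<phi> \<kappa>. \<kappa> > 1 \<and> acts \<phi> \<kappa>" "\<exists>\<phi> \<kappa>. 0 < \<kappa> \<and> \<kappa> < 1 \<and> acts \<phi> \<kappa>"
proof -
  obtain g where g: "g \<in> deck_group f" "hyperbolic g" "\<zeta> \<in> boundary_fixed_points g"
    using assms(1) by (auto simp: hyperbolic_fixed_points_def)
  have "g 0 \<noteq> 0" using g(2) by (auto simp: hyperbolic_def)
  then have *: "norm \<zeta> = 1 \<and> (\<exists>\<kappa> \<beta>. \<kappa> > 0 \<and> \<kappa> \<noteq> 1 \<and>
      (\<forall>z\<in>unit_disc. cayley \<zeta> (g z) = of_real \<kappa> * cayley \<zeta> z + \<i> * of_real \<beta>))"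
    by (intro deck_hyperbolic(2)[OF g(1) _ _ g(3), of 0]) auto
  then show "norm \<zeta> = 1" ..
  from * obtain \<kappa> \<beta> where \<kappa>: "\<kappa> > 0" "\<kappa> \<noteq> 1"
    and aff: "\<forall>z\<in>unit_disc. cayley \<zeta> (g z) = of_real \<kappa> * cayley \<zeta> z + \<i> * of_real \<beta>"
    by blast
  obtain h where h: "\<forall>z\<in>unit_disc. g z \<in> unit_disc \<and> h z \<in> unit_disc \<and> g (h z) = z \<and>
      f (g z) = f z \<and> f (h z) = f z"
    using deck_inverse[OF g(1)] by blast
  have affh: "cayley \<zeta> (h z) = of_real (1 / \<kappa>) * cayley \<zeta> z + \<i> * of_real (- \<beta> / \<kappa>)" if "z \<in> unit_disc" for z
  proof -
    have "cayley \<zeta> z = of_real \<kappa> * cayley \<zeta> (h z) + \<i> * of_real \<beta>" using aff h that by fastforce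
    then show ?thesis using \<kappa>(1) by (simp add: field_simps)
  qed
  have 1: "acts g \<kappa>" unfolding acts_def using h aff by blast
  have 2: "acts h (1 / \<kappa>)" unfolding acts_def using h affh by blast
  show "\<exists>\<phi> \<kappa>. \<kappa> > 1 \<and> acts \<phi> \<kappa>"
    using 1 2 \<kappa> by (cases "\<kappa> > 1") (blast, intro exI[of _ h] exI[of _ "1 / \<kappa>"], simp)
  show "\<exists>\<phi> \<kappa>. 0 < \<kappa> \<and> \<kappa> < 1 \<and> acts \<phi> \<kappa>"
  proof (cases "\<kappa> < 1")
    case False
    then have "0 < 1 / \<kappa> \<and> 1 / \<kappa> < 1" using \<kappa> by simp
    then show ?thesis using 2 by blast
  qed (use 1 \<kappa> in blast)
qed

text \<open>Each iteration of the map with factor above 1 multiplies the Poisson kernel at \<zeta>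
  by \<kappa>, so the iterates of 0, all in one fibre, converge to \<zeta>.\<close>

lemma hyperbolic_fixed_points_subset_limit_set:
  "hyperbolic_fixed_points (deck_group f) \<subseteq> limit_set (deck_group f)"
proof
  fix \<zeta> assume *: "\<zeta> \<in> hyperbolic_fixed_points (deck_group f)"
  have \<zeta>: "norm \<zeta> = 1" using hyperbolic_fixed_point_maps(1)[OF *] .
  obtain \<phi> \<kappa> \<beta> where \<kappa>: "\<kappa> > 1" and \<phi>:
    "\<forall>z\<in>unit_disc. \<phi> z \<in> unit_disc \<and> f (\<phi> z) = f z \<and>
      cayley \<zeta> (\<phi> z) = of_real \<kappa> * cayley \<zeta> z + \<i> * of_real \<beta>"
    using hyperbolic_fixed_point_maps(2)[OF *] by blast
  have c0: "Re (cayley \<zeta> 0) = 1" using cayley_radius[OF \<zeta>, of 0] by simp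
  have 0: "0 \<in> unit_disc" by simp
  note it = funpow_affine[of unit_disc \<phi> "cayley \<zeta>" \<kappa> \<beta> 0, OF _ _ 0]
  have itS: "(\<phi> ^^ n) 0 \<in> unit_disc" "Re (cayley \<zeta> ((\<phi> ^^ n) 0)) = \<kappa> ^ n" for n
    using it(1,2)[of n] \<phi> c0 by auto
  have itf: "f ((\<phi> ^^ n) 0) = f 0" for n by (induction n) (use itS \<phi> in auto)
  have "\<zeta> islimpt {x \<in> unit_disc. f x = f 0}"
    unfolding islimpt_approachable
  proof (intro allI impI)
    fix e :: real assume e: "e > 0"
    obtain n where n: "2 / e < \<kappa> ^ n" using real_arch_pow[OF \<kappa>] by blast
    let ?w = "(\<phi> ^^ n) 0"
    have w: "norm ?w < 1" using itS(1)[of n] by simp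
    have "norm (\<zeta> - ?w) * \<kappa> ^ n \<le> norm (\<zeta> - ?w) * norm (cayley \<zeta> ?w)"
      using itS(2)[of n] complex_Re_le_cmod[of "cayley \<zeta> ?w"] by (intro mult_left_mono) auto
    also have "\<dots> \<le> 2" by (rule dist_le_of_cayley[OF \<zeta> w])
    also have "2 < e * \<kappa> ^ n" using n e by (simp add: field_simps)
    finally have "norm (\<zeta> - ?w) < e" using \<kappa> by simp
    then have "dist ?w \<zeta> < e" by (simp add: dist_norm norm_minus_commute)
    moreover have "?w \<noteq> \<zeta>" using w \<zeta> by auto
    ultimately show "\<exists>x'\<in>{x \<in> unit_disc. f x = f 0}. x' \<noteq> \<zeta> \<and> dist x' \<zeta> < e"
      using itS(1)[of n] itf[of n] by blast
  qed
  then show "\<zeta> \<in> limit_set (deck_group f)" unfolding limit_set_eq by (auto intro!: bexI[of _ 0])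
qed

text \<open>Let \<open>g z0\<close> be near \<zeta>, and let \<open>a\<close> be the fixed point of
  \<open>g\<close> with factor above 1. The Poisson kernel at \<open>a\<close> is at least as large
  at \<open>g z0\<close> as at \<open>z0\<close>; near the circle this is possible only close to
  \<open>a\<close>.\<close>

lemma limit_set_subset_closure:
  "limit_set (deck_group f) \<subseteq> closure (hyperbolic_fixed_points (deck_group f))"
proof
  fix \<zeta> assume L: "\<zeta> \<in> limit_set (deck_group f)"
  then have \<zeta>: "norm \<zeta> = 1" using limit_set_subset_circle by auto
  obtain z0 where z0: "z0 \<in> unit_disc" and lim: "\<zeta> islimpt {g z0 |g. g \<in> deck_group f}"
    using L unfolding limit_set_def by blast
  \<comment> \<open>A lower bound for the Poisson kernel at \<open>z0\<close>, uniform over the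
    points of the circle, whose distance from \<open>z0\<close> is at most 2.\<close>
  define m where "m = (1 - (norm z0)\<^sup>2) / 4"
  have m: "m > 0" using z0 by (simp add: m_def abs_square_less_1)
  show "\<zeta> \<in> closure (hyperbolic_fixed_points (deck_group f))"
    unfolding closure_approachable
  proof (intro allI impI)
    fix e :: real assume e: "e > 0"
    \<comment> \<open>The three bounds serve, in turn, the final triangle inequality, the condition
      \<open>g z0 \<noteq> z0\<close>, and the estimate of \<open>norm (a - g z0)\<close> by
      \<open>e / 2\<close>.\<close>
    define d where "d = min (min (e / 2) (dist z0 \<zeta>)) (m * e\<^sup>2 / 16)"
    have "z0 \<noteq> \<zeta>" using z0 \<zeta> by auto
    then have d: "d > 0" "d \<le> e / 2" "d \<le> dist z0 \<zeta>" "d \<le> m * e\<^sup>2 / 16" using e m by (auto simp: d_def)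
    obtain g where g: "g \<in> deck_group f" "dist (g z0) \<zeta> < d"
      using lim d(1) unfolding islimpt_approachable by blast
    have "g z0 \<noteq> z0" using g d by auto
    then obtain a \<kappa> \<beta> where a: "a \<in> boundary_fixed_points g" "\<kappa> > 1"
      "\<And>z. z \<in> unit_disc \<Longrightarrow> cayley a (g z) = of_real \<kappa> * cayley a z + \<i> * of_real \<beta>"
      using deck_hyperbolic(3)[OF g(1) z0] by blast
    have na: "norm a = 1" using a by (simp add: boundary_fixed_points_def)
    let ?w = "g z0"
    have "?w \<in> unit_disc" using deck_inverse[OF g(1)] z0 by blast
    then have w: "norm ?w < 1" by simp
    have aw: "a \<noteq> ?w" "a \<noteq> z0" using na w z0 by auto
    have "m \<le> Re (cayley a z0)"
    proof -
      have "norm (a - z0) \<le> 2" using norm_triangle_ineq4[of a z0] na z0 by simp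
      then have "(norm (a - z0))\<^sup>2 \<le> 2\<^sup>2" by (intro power_mono) auto
      then show ?thesis
        unfolding Re_cayley[OF na] m_def using z0 aw by (intro divide_left_mono) (auto simp: abs_square_le_1)
    qed
    also have "\<dots> \<le> \<kappa> * Re (cayley a z0)"
      using a(2) Re_cayley_pos[OF na, of z0] z0 by simp
    also have "\<dots> = Re (cayley a ?w)" using a(3)[OF z0] by simp
    finally have "m \<le> (1 - (norm ?w)\<^sup>2) / (norm (a - ?w))\<^sup>2" unfolding Re_cayley[OF na] .
    then have "m * (norm (a - ?w))\<^sup>2 \<le> 1 - (norm ?w)\<^sup>2" using aw by (simp add: field_simps)
    also have "\<dots> = (1 - norm ?w) * (1 + norm ?w)" by (simp add: power2_eq_square algebra_simps)
    also have "\<dots> \<le> d * 2"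
    proof (rule mult_mono)
      have "norm \<zeta> - norm ?w \<le> dist ?w \<zeta>" by (metis dist_norm norm_minus_commute norm_triangle_ineq2)
      then show "1 - norm ?w \<le> d" using g(2) \<zeta> by simp
    qed (use w d in auto)
    also have "\<dots> \<le> m * e\<^sup>2 / 8" using d(4) by simp
    finally have "m * (norm (a - ?w))\<^sup>2 \<le> m * (e\<^sup>2 / 8)" by simp
    then have "(norm (a - ?w))\<^sup>2 \<le> e\<^sup>2 / 8" using m by simp
    also have "\<dots> < (e / 2)\<^sup>2" using e by (simp add: power2_eq_square)
    finally have "norm (a - ?w) < e / 2" using e by (meson half_gt_zero less_imp_le power_less_imp_less_base)
    then have "dist a \<zeta> < e" using g(2) d(2) dist_triangle[of a \<zeta> ?w] by (simp add: dist_norm)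
    moreover have "a \<in> hyperbolic_fixed_points (deck_group f)"
      unfolding hyperbolic_fixed_points_def
      using g(1) a(1) deck_hyperbolic(1)[OF g(1) z0 \<open>g z0 \<noteq> z0\<close>] by blast
    ultimately show "\<exists>y\<in>hyperbolic_fixed_points (deck_group f). dist y \<zeta> < e" by blast
  qed
qed

text \<open>Iterates of the map with factor below 1 leave \<open>f\<close> unchanged and bring the
  half-plane coordinate of any point of the radius into a fixed compact rectangle.\<close>

lemma radius_over_compact:
  assumes "cis \<theta> \<in> hyperbolic_fixed_points (deck_group f)"
  obtains K where "compact K" "K \<subseteq> D" "\<And>t. 0 \<le> t \<Longrightarrow> t < 1 \<Longrightarrow> f (of_real t * cis \<theta>) \<in> K"
proof -
  define \<zeta> where "\<zeta> = cis \<theta>"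
  have *: "\<zeta> \<in> hyperbolic_fixed_points (deck_group f)" using assms by (simp add: \<zeta>_def)
  have \<zeta>: "norm \<zeta> = 1" using hyperbolic_fixed_point_maps(1)[OF *] .
  obtain \<psi> \<kappa> \<beta> where \<kappa>: "0 < \<kappa>" "\<kappa> < 1" and \<psi>:
    "\<forall>z\<in>unit_disc. \<psi> z \<in> unit_disc \<and> f (\<psi> z) = f z \<and>
      cayley \<zeta> (\<psi> z) = of_real \<kappa> * cayley \<zeta> z + \<i> * of_real \<beta>"
    using hyperbolic_fixed_point_maps(3)[OF *] by blast
  \<comment> \<open>The fixed point of
    \<open>\<lambda>y. \<kappa> * y + \<bar>\<beta>\<bar>\<close>: imaginary parts bounded by
    \<open>b\<close> remain so under iteration.\<close>
  define b where "b = \<bar>\<beta>\<bar> / (1 - \<kappa>)"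
  have b: "b \<ge> 0" "\<kappa> * b + \<bar>\<beta>\<bar> = b" using \<kappa> by (simp_all add: b_def field_simps)
  define Q where "Q = cbox (Complex \<kappa> (- b)) (Complex 1 b)"
  \<comment> \<open>The inverse of the coordinate \<open>cayley \<zeta>\<close>.\<close>
  define v where "v = (\<lambda>u. \<zeta> * ((u - 1) / (u + 1)))"
  have Qpos: "Re u > 0" if "u \<in> Q" for u using that \<kappa> by (simp add: Q_def in_cbox_complex_iff)
  have v1: "v ` Q \<subseteq> unit_disc"
  proof (rule image_subsetI)
    fix u assume "u \<in> Q"
    then show "v u \<in> unit_disc"
      using norm_cayley_inverse_lt_1[OF Qpos] \<zeta> unfolding v_def mem_ball_0 norm_mult by simp
  qed
  have "continuous_on Q v" unfolding v_def
  proof (intro continuous_intros ballI)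
    fix u assume "u \<in> Q"
    then show "u + 1 \<noteq> 0" using Qpos[of u] by (auto simp: complex_eq_iff)
  qed
  then have "compact (v ` Q)" unfolding Q_def by (intro compact_continuous_image compact_cbox)
  then have "compact (f ` v ` Q)"
    by (rule compact_continuous_image[OF continuous_on_subset[OF holomorphic_on_imp_continuous_on[OF holo] v1]])
  moreover have "f ` v ` Q \<subseteq> D" using v1 maps by blast
  moreover have "f (of_real t * cis \<theta>) \<in> f ` v ` Q" if t: "0 \<le> t" "t < 1" for t
  proof -
    define z where "z = of_real t * \<zeta>"
    have z: "z \<in> unit_disc" using radius_in_disc[OF t] by (simp add: z_def \<zeta>_def)
    define x where "x = (1 + t) / (1 - t)"
    have x: "x \<ge> 1" using t by (simp add: x_def)
    have cz: "cayley \<zeta> z = of_real x" by (simp add: z_def x_def cayley_radius[OF \<zeta>])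
    obtain n where n: "\<kappa> \<le> \<kappa> ^ n * x" "\<kappa> ^ n * x \<le> 1" using power_in_window[OF \<kappa> x] by blast
    note it = funpow_affine[of unit_disc \<psi> "cayley \<zeta>" \<kappa> \<beta> z, OF _ _ z]
    have itS: "(\<psi> ^^ n) z \<in> unit_disc" "Re (cayley \<zeta> ((\<psi> ^^ n) z)) = \<kappa> ^ n * x" for n
      using it(1,2)[of n] \<psi> cz by auto
    have itf: "f ((\<psi> ^^ n) z) = f z" for n by (induction n) (use itS \<psi> in auto)
    have Im: "\<bar>Im (cayley \<zeta> ((\<psi> ^^ n) z))\<bar> \<le> b" for n
    proof (induction n)
      case 0
      then show ?case using cz b by simp
    next
      case (Suc n)
      have "\<bar>Im (cayley \<zeta> ((\<psi> ^^ Suc n) z))\<bar> = \<bar>\<kappa> * Im (cayley \<zeta> ((\<psi> ^^ n) z)) + \<beta>\<bar>"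
        using it(3)[of n] \<psi> by auto
      also have "\<dots> \<le> \<kappa> * \<bar>Im (cayley \<zeta> ((\<psi> ^^ n) z))\<bar> + \<bar>\<beta>\<bar>"
        using \<kappa> by (metis abs_mult abs_of_pos abs_triangle_ineq)
      also have "\<dots> \<le> \<kappa> * b + \<bar>\<beta>\<bar>" using Suc \<kappa> by simp
      finally show ?case using b by simp
    qed
    let ?w = "(\<psi> ^^ n) z"
    have "cayley \<zeta> ?w \<in> Q"
      using n itS(2)[of n] Im[of n] by (auto simp: Q_def in_cbox_complex_iff abs_le_iff)
    moreover have "?w = v (cayley \<zeta> ?w)"
      unfolding v_def using cayley_inverse[OF \<zeta>] itS(1)[of n] by simp
    ultimately have "?w \<in> v ` Q" by blast
    then show ?thesis using itf[of n] unfolding z_def \<zeta>_def by (metis imageI)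
  qed
  ultimately show ?thesis using that by blast
qed

text \<open>By \<open>radius_over_compact\<close> the lower bound for the derivative holds on the
  whole radius; the constant is halved because the hyperbolic density carries the factor 2.\<close>

lemma length_ge_at_hyperbolic_fixed_point:
  assumes "cis \<theta> \<in> hyperbolic_fixed_points (deck_group f)"
  shows "\<exists>K>0. \<forall>r\<in>{0..<1}. euclidean_length f r \<theta> \<ge> K * hyperbolic_length r"
proof -
  obtain K where K: "compact K" "K \<subseteq> D" "\<And>t. 0 \<le> t \<Longrightarrow> t < 1 \<Longrightarrow> f (of_real t * cis \<theta>) \<in> K"
    using radius_over_compact[OF assms] by blast
  obtain d where d: "d > 0" "\<And>t \<omega>. 0 \<le> t \<Longrightarrow> t < 1 \<Longrightarrow> norm \<omega> = 1 \<Longrightarrow> f (of_real t * \<omega>) \<in> K \<Longrightarrow>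
    norm (deriv f (of_real t * \<omega>)) * (1 - t) \<ge> d"
    using deriv_lower_bound[OF K(1,2)] by blast
  have "d / 2 * hyperbolic_length r - d / 2 * hyperbolic_length 0 \<le> euclidean_length f r \<theta>"
    if r: "r \<in> {0..<1}" for r
  proof (rule euclidean_length_ge)
    fix t :: real assume t: "0 \<le> t" "t < 1"
    show "((\<lambda>t. d / 2 * hyperbolic_length t) has_real_derivative d / 2 * (2 / (1 - t\<^sup>2))) (at t)"
      by (intro DERIV_cmult DERIV_hyperbolic_length t)
    have "d / 2 * (2 / (1 - t\<^sup>2)) = d * (1 / (1 - t\<^sup>2))" by simp
    also have "\<dots> \<le> d * (1 / (1 - t))"
      using d inverse_one_minus_bounds(2)[OF t] by (intro mult_left_mono) auto
    also have "\<dots> \<le> norm (deriv f (of_real t * cis \<theta>))"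
      using d(2)[OF t norm_cis K(3)[OF t]] t by (simp add: field_simps)
    finally show "d / 2 * (2 / (1 - t\<^sup>2)) \<le> norm (deriv f (of_real t * cis \<theta>))" .
  qed (use r in auto)
  then show ?thesis using d by (intro exI[of _ "d / 2"]) (simp add: hyperbolic_length_0)
qed

end

theorem theorem9p1:
  fixes D :: "complex set"
    and k :: nat
    and C :: "nat \<Rightarrow> complex set"
    and f :: "complex \<Rightarrow> complex"
    and G :: "(complex \<Rightarrow> complex) set"
    and L :: "complex set"
  assumes "open D" "connected D" "D \<noteq> {}" "bounded D"
    and "finite (components (- D))"
    and "frontier D = (\<Union>i\<in>{1..k}. C i)"
    and "\<And>i. i \<in> {1..k} \<Longrightarrow> smooth_closed_curve (C i)"
    and "\<And>i. i \<in> {1..k} \<Longrightarrow> \<not> (\<exists>p. C i = {p})"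
    and "disjoint_family_on C {1..k}"
    and "f holomorphic_on unit_disc"
    and "covering_space unit_disc f D"
    and "G = deck_group f"
    and "L = limit_set G"
  shows "(\<forall>\<theta>. (\<lambda>r. euclidean_length f r \<theta>) \<in> O[at_left 1](hyperbolic_length)) \<and>
    (\<forall>\<theta>. cis \<theta> \<notin> L \<longrightarrow> (\<lambda>r. euclidean_length f r \<theta>) \<in> O[at_left 1](\<lambda>_. 1)) \<and>
    (\<forall>\<theta>. cis \<theta> \<in> hyperbolic_fixed_points G \<longrightarrow>
        (\<exists>K>0. \<forall>r\<in>{0..<1}. euclidean_length f r \<theta> \<ge> K * hyperbolic_length r)) \<and>
    hyperbolic_fixed_points G \<subseteq> L \<and> L \<subseteq> closure (hyperbolic_fixed_points G)"
proof -
  \<comment> \<open>The disjoint smooth curves supply the local graph that the locale asks for at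
    each frontier point.\<close>
  interpret graph_domain f D
  proof
    fix p assume "p \<in> frontier D"
    then have "p \<in> (\<Union>i\<in>{1..k}. C i)" using assms(6) by simp
    then show "\<exists>v \<phi> r. graph_at (frontier D) p v \<phi> r"
      using disjoint_curves_graph_at[of "{1..k}" C p] assms(6,7,9) by (metis finite_atLeastAtMost)
  qed (use assms in auto)
  show ?thesis
    using length_bigo_hyperbolic length_bounded_off_limit_set length_ge_at_hyperbolic_fixed_point
      hyperbolic_fixed_points_subset_limit_set limit_set_subset_closure
    unfolding assms(12,13) by blast
qed

end
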